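(* There exists a constant $C$, independent of $n$, such that for every integer $n\ge 1$, if $\pi$ is a uniformly random permutation in $S_n$, then $$d_K\left(\frac{LA_n(\pi)-\left(\frac{2n}{3}+\frac16\right)}{\sqrt{\frac{8n}{45}-\frac{13}{180}}},\; Z\right)\le\frac{C}{\sqrt n},$$ where $Z$ is a standard normal random variable.
   Context: For a sequence $\mathbf{x}=(x_1,\dots,x_n)$ of real numbers, a subsequence $x_{i_1},\dots,x_{i_k}$ with $1\le i_1<\dots<i_k\le n$ is called alternating if $x_{i_1}>x_{i_2}<x_{i_3}>\cdots x_{i_k}$ (strict inequalities of alternating direction, starting with $>$; any subsequence of length 1 is alternating). $LA_n(\mathbf{x})$ is the maximal $k$ such that $\mathbf{x}$ has an alternating subsequence of length $k$. For $\pi\in S_n$, $LA_n(\pi)=LA_n(\pi(1),\dots,\pi(n))$. The Kolmogorov distance between two real random variables (i.e. between their laws) is $d_K(X,Y)=\sup_{z\in\mathbb{R}}|\mathbb{P}(X\le z)-\mathbb{P}(Y\le z)|$. *)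

theory Defs
  imports "HOL-Probability.Probability" "HOL-Library.Sublist" "HOL-Combinatorics.Permutations"
begin

text \<open>List positions are 0-based, so the first comparison, at the even position 0, is a descent.\<close>

definition alternating :: "real list \<Rightarrow> bool" where
  "alternating ys \<longleftrightarrow>
     (\<forall>i. Suc i < length ys \<longrightarrow>
        (if even i then ys ! i > ys ! Suc i else ys ! i < ys ! Suc i))"

text \<open>The empty subsequence is also admitted; it affects the maximum only for
  the empty sequence, where it gives 0.\<close>

definition LA :: "real list \<Rightarrow> nat" where
  "LA xs = Max {length ys | ys. subseq ys xs \<and> alternating ys}"

definition LA_perm :: "nat \<Rightarrow> (nat \<Rightarrow> nat) \<Rightarrow> nat" where
  "LA_perm n \<pi> = LA (map (\<lambda>i. real (\<pi> i)) [1..<Suc n])"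

definition uniform_perm :: "nat \<Rightarrow> (nat \<Rightarrow> nat) pmf" where
  "uniform_perm n = pmf_of_set {\<pi>. \<pi> permutes {1..n}}"

text \<open>The Kolmogorov distance depends only on the laws, so it is defined on laws of
  real random variables. For probability measures the supremum is over a bounded set.\<close>

definition kolmogorov_dist :: "real measure \<Rightarrow> real measure \<Rightarrow> real" where
  "kolmogorov_dist M N = (SUP z. \<bar>cdf M z - cdf N z\<bar>)"

end

theory Submission
  imports Defs
    "HOL-Computational_Algebra.Fundamental_Theorem_Algebra"
    "HOL-Real_Asymp.Real_Asymp"
begin

text \<open>
  \<^emph>\<open>Combinatorics.\<close> For distinct entries, the longest alternating subsequence consists of the turning
  points, so \<open>LA\<close> is one plus the number of changes of direction (the first entry counting as an ascent).
  A new maximum inserted into the \<open>n + 1\<close> gaps of a permutation of \<open>n\<close> elements with \<open>LA = k\<close> keeps \<open>LA\<close> in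
  \<open>k\<close> gaps, raises it by 1 in one gap and by 2 in the other \<open>n - k\<close> gaps (\<open>sum_LA_insert_max\<close>). Thus the
  polynomials \<open>T\<^sub>n = \<Sum>\<^sub>\<pi> X ^ LA(\<pi>)\<close> satisfy \<open>T\<^sub>n\<^sub>+\<^sub>1 = X (1 - X\<^sup>2) T\<^sub>n' + (X + n X\<^sup>2) T\<^sub>n\<close>.

  \<^emph>\<open>Real zeros.\<close> All zeros of \<open>T\<^sub>n\<close> are real and nonpositive. After division by
  \<open>(1 + X) ^ (n div 2)\<close>, the recurrence amounts to forming a polar derivative \<open>(1 - z) p' + N p\<close>, with one
  more zero at \<open>-1\<close> adjoined at every second step. This derivative equals \<open>p\<close> times a combination of the
  numbers \<open>1/(z - r)\<close>, \<open>r\<close> running over the zeros of \<open>p\<close>, with positive coefficients. If \<open>z\<close> is not on the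
  nonpositive axis and all \<open>r\<close> are, these numbers lie in a common open half plane, so the combination does
  not vanish (\<open>polar_derivative_eval\<close>, \<open>LA_poly_factor\<close>). Therefore \<open>T\<^sub>n/n!\<close> is a product of factors
  \<open>(1 - q) + q X\<close> with \<open>0 \<le> q \<le> 1\<close>: \<open>LA\<close> has the law of a sum of independent Bernoulli variables
  (\<open>LA_poisson_binomial\<close>).

  \<^emph>\<open>Normal approximation.\<close> For a sum of independent Bernoulli variables with variance \<open>\<sigma>\<^sup>2\<close>, Stein's method
  gives the distance at most \<open>9/\<sigma>\<close> (\<open>pb_berry_esseen\<close>). It rests on a covariance identity with discrete
  increments; the same identity, applied to a truncated linear function, yields the concentration
  inequality that controls the jump of the indicator. The recurrence also gives the mean
  \<open>2n/3 + 1/6\<close> for \<open>n \<ge> 2\<close> and the variance \<open>8n/45 - 13/180\<close> for \<open>n \<ge> 4\<close>, and smaller \<open>n\<close> are trivial.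
\<close>

section \<open>Alternating subsequences and insertion of a maximum\<close>

text \<open>The Boolean is the direction. Negation exchanges ascents and descents, so a statement for all \<open>up\<close>
  covers both.\<close>

definition step :: "bool \<Rightarrow> real \<Rightarrow> real \<Rightarrow> bool" where
  "step up x y \<longleftrightarrow> (if up then x < y else y < x)"

fun zigzag :: "bool \<Rightarrow> real list \<Rightarrow> bool" where
  "zigzag up [] \<longleftrightarrow> True"
| "zigzag up [x] \<longleftrightarrow> True"
| "zigzag up (x # y # ys) \<longleftrightarrow> step up x y \<and> zigzag (\<not> up) (y # ys)"

text \<open>The number of changes of direction made while reading \<open>ys\<close> from the value \<open>x\<close>, reached in
  the direction \<open>up\<close>; the first entry of a sequence counts as reached by an ascent.\<close>

fun turns :: "bool \<Rightarrow> real \<Rightarrow> real list \<Rightarrow> nat" where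
  "turns up x [] = 0"
| "turns up x (y # ys) = (if step up x y then turns up y ys else Suc (turns (\<not> up) y ys))"

lemma step_trans: "step up x y \<Longrightarrow> step up y z \<Longrightarrow> step up x z"
  by (auto simp: step_def split: if_splits)

lemma not_step_iff: "x \<noteq> y \<Longrightarrow> \<not> step up x y \<longleftrightarrow> step (\<not> up) x y"
  by (auto simp: step_def)

lemma step_swap: "step (\<not> up) x y \<longleftrightarrow> step up y x"
  by (auto simp: step_def)

lemma zigzag_nth:
  "zigzag up ys \<longleftrightarrow> (\<forall>i. Suc i < length ys \<longrightarrow> step (if even i then up else \<not> up) (ys ! i) (ys ! Suc i))"
proof (induction up ys rule: zigzag.induct)
  case (3 up x y ys)
  have split0: "(\<forall>i. P i) \<longleftrightarrow> P 0 \<and> (\<forall>i. P (Suc i))" for P :: "nat \<Rightarrow> bool"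
    by (metis nat.exhaust)
  have "(if even (Suc i) then up else \<not> up) = (if even i then \<not> up else \<not> \<not> up)" for i
    by simp
  then show ?case
    unfolding zigzag.simps 3 by (subst (2) split0) simp
qed auto

lemma alternating_iff_zigzag: "alternating ys \<longleftrightarrow> zigzag False ys"
  unfolding alternating_def zigzag_nth by (auto simp: step_def)

lemma zigzag_Cons: "zigzag up (x # ys) \<longleftrightarrow> ys = [] \<or> step up x (hd ys) \<and> zigzag (\<not> up) ys"
  by (cases ys) auto

text \<open>A zigzag subsequence cannot beat the greedy count. When the next entry \<open>y\<close> continues in the
  current direction, it is a more extreme value than \<open>x\<close>, so a subsequence starting at \<open>x\<close> may start
  at \<open>y\<close> instead; when \<open>y\<close> turns around, dropping the first entry costs one and so does the turn.\<close>

lemma zigzag_length_le_turns: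
  "\<lbrakk>distinct (x # xs); subseq ys (x # xs); zigzag (\<not> up) ys\<rbrakk> \<Longrightarrow> length ys \<le> Suc (turns up x xs)"
proof (induction xs arbitrary: x up ys)
  case Nil
  then show ?case
    by (auto simp: subseq_Cons' dest: list_emb_length)
next
  case (Cons y zs)
  have IH: "length ws \<le> Suc (turns u y zs)" if "subseq ws (y # zs)" "zigzag (\<not> u) ws" for u ws
    using Cons.IH[of y ws u] Cons.prems(1) that by simp
  show ?case
  proof (cases "step up x y")
    case True
    then have t: "turns up x (y # zs) = turns up y zs" by simp
    show ?thesis
    proof (cases "subseq ys (y # zs)")
      case True
      then show ?thesis using IH Cons.prems t by simp
    next
      case False
      then obtain ys' where ys: "ys = x # ys'" "subseq ys' (y # zs)"
        using Cons.prems(2) by (cases ys) (auto split: if_splits)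
      show ?thesis
      proof (cases ys')
        case Nil
        then show ?thesis by (simp add: ys)
      next
        case (Cons w ws)
        with Cons.prems(3) ys have w: "step (\<not> up) x w" "zigzag up (w # ws)" by auto
        then have yw: "step (\<not> up) y w"
          using True step_trans[of "\<not> up" y x w] step_swap[of up y x] by simp
        then have "w \<noteq> y" by (auto simp: step_def split: if_splits)
        then have "subseq (w # ws) zs"
          using ys(2) Cons by (auto split: if_splits)
        then have "subseq (y # w # ws) (y # zs)" by simp
        moreover have "zigzag (\<not> up) (y # w # ws)" using yw w by simp
        ultimately show ?thesis using IH[of "y # w # ws" up] t ys Cons by simp
      qed
    qed
  next
    case False
    then have t: "turns up x (y # zs) = Suc (turns (\<not> up) y zs)" by simp
    obtain ws where ws: "length ys \<le> Suc (length ws)" "subseq ws (y # zs)" "zigzag up ws"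
    proof (cases ys)
      case Nil
      then show ?thesis using that[of "[]"] by simp
    next
      case (Cons v vs)
      moreover have "subseq vs (y # zs)"
        using Cons.prems(2) unfolding Cons
        by (cases "v = x"; cases "v = y") (auto dest: subseq_Cons' intro: list_emb_Cons)
      moreover have "zigzag up vs" using Cons.prems(3) Cons by (auto simp: zigzag_Cons)
      ultimately show ?thesis using that[of vs] by simp
    qed
    show ?thesis using IH[of ws "\<not> up"] ws t by simp
  qed
qed

text \<open>The turning points form a zigzag of the greedy length. The clause on the first entry, which may
  lie further than \<open>x\<close> in the current direction, is what allows another entry to be put in front.\<close>

lemma zigzag_attaining_turns:
  assumes "distinct (x # xs)"
  shows "\<exists>ys. subseq ys (x # xs) \<and> zigzag (\<not> up) ys \<and> length ys = Suc (turns up x xs)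
     \<and> (hd ys = x \<or> step up x (hd ys))"
  using assms
proof (induction xs arbitrary: x up)
  case Nil
  show ?case by (intro exI[of _ "[x]"]) simp
next
  case (Cons y zs)
  have d: "distinct (y # zs)" and xy: "x \<noteq> y" using Cons.prems by auto
  show ?case
  proof (cases "step up x y")
    case True
    obtain ys where "subseq ys (y # zs)" "zigzag (\<not> up) ys" "length ys = Suc (turns up y zs)"
      "hd ys = y \<or> step up y (hd ys)"
      using Cons.IH[OF d, of up] by auto
    then show ?thesis
      using True step_trans[of up x y "hd ys"] by (intro exI[of _ ys]) (auto intro: list_emb_Cons)
  next
    case False
    then have s: "step (\<not> up) x y" using not_step_iff[OF xy] by simp
    obtain ys where ys: "subseq ys (y # zs)" "zigzag up ys" "length ys = Suc (turns (\<not> up) y zs)"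
      "hd ys = y \<or> step (\<not> up) y (hd ys)"
      using Cons.IH[OF d, of "\<not> up"] by auto
    then have "step (\<not> up) x (hd ys)" using s step_trans[of "\<not> up" x y "hd ys"] by auto
    then have "zigzag (\<not> up) (x # ys)" using ys by (simp add: zigzag_Cons)
    then show ?thesis using ys False by (intro exI[of _ "x # ys"]) auto
  qed
qed

lemma LA_Nil: "LA [] = 0"
proof -
  have "{length ys | ys. subseq ys [] \<and> alternating ys} = {0}"
    by (auto simp: alternating_def)
  then show ?thesis by (simp add: LA_def)
qed

lemma LA_eq_turns:
  assumes "distinct (x # xs)"
  shows "LA (x # xs) = Suc (turns True x xs)"
  unfolding LA_def
proof (rule Max_eqI)
  show "finite {length ys |ys. subseq ys (x # xs) \<and> alternating ys}"
    by (rule finite_subset[of _ "{..length (x # xs)}"]) (use list_emb_length in fastforce)+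
  show "k \<le> Suc (turns True x xs)" if "k \<in> {length ys |ys. subseq ys (x # xs) \<and> alternating ys}" for k
    using that zigzag_length_le_turns[OF assms, of _ True] by (auto simp: alternating_iff_zigzag)
  show "Suc (turns True x xs) \<in> {length ys |ys. subseq ys (x # xs) \<and> alternating ys}"
    using zigzag_attaining_turns[OF assms, of True] by (force simp: alternating_iff_zigzag)
qed

definition insert_at :: "'a \<Rightarrow> nat \<Rightarrow> 'a list \<Rightarrow> 'a list" where
  "insert_at a i xs = take i xs @ a # drop i xs"

lemma insert_at_0 [simp]: "insert_at a 0 xs = a # xs"
  and insert_at_Suc [simp]: "insert_at a (Suc i) (x # xs) = x # insert_at a i xs"
  by (simp_all add: insert_at_def)

text \<open>How the count of turns responds to a new maximum put into each of the gaps. A maximum next to an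
  existing peak does not change the count, and one in the interior of a run creates a new peak and a new
  valley. The two directions are proved together because a turn exchanges them. The extra term on the
  left of the first identity stands for the gap in front of \<open>x\<close>, which makes the formula uniform.\<close>

lemma sum_turns_insert_max:
  fixes f :: "nat \<Rightarrow> 'a::comm_ring_1"
  assumes "distinct (x # xs)" "\<forall>z\<in>set (x # xs). z < M"
  shows "f (Suc (turns False x xs)) + (\<Sum>i\<le>length xs. f (turns True x (insert_at M i xs)))
         = (let k = turns True x xs in of_nat (Suc k) * f k + f (k + 1)
              + (of_nat (length xs) - of_nat k) * f (k + 2))" (is ?U)
    and "(\<Sum>i\<le>length xs. f (turns False x (insert_at M i xs)))
         = (let k = turns False x xs in of_nat k * f k + f (k + 1)
              + (of_nat (length xs) - of_nat k) * f (k + 2))" (is ?D)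
proof -
  have "?U \<and> ?D" using assms
  proof (induction xs arbitrary: x f)
    case Nil
    then show ?case by (simp add: step_def Let_def)
  next
    case (Cons y ys)
    have xM: "step True x M" "\<not> step False x M" and yM: "\<not> step True M y" "step False M y"
      using Cons.prems by (auto simp: step_def)
    have u0: "turns True x (M # y # ys) = Suc (turns False y ys)"
     and d0: "turns False x (M # y # ys) = Suc (Suc (turns False y ys))"
      using xM yM by simp_all
    note IHU = conjunct1[OF Cons.IH[of y]] and IHD = conjunct2[OF Cons.IH[of y]]
    show ?case
    proof (cases "x < y")
      case True
      then have s: "step True x y" "\<not> step False x y" by (auto simp: step_def)
      then show ?thesis
        using Cons.prems IHU[of f] IHU[of "\<lambda>k. f (Suc k)"] u0 d0
        by (simp add: sum.atMost_Suc_shift Let_def algebra_simps del: sum.atMost_Suc)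
    next
      case False
      then have s: "\<not> step True x y" "step False x y" using Cons.prems by (auto simp: step_def)
      then show ?thesis
        using Cons.prems IHD[of f] IHD[of "\<lambda>k. f (Suc k)"] u0 d0
        by (simp add: sum.atMost_Suc_shift Let_def algebra_simps del: sum.atMost_Suc)
    qed
  qed
  then show ?U ?D by blast+
qed

text \<open>Of the \<open>n + 1\<close> gaps of a sequence of length \<open>n\<close>, exactly \<open>LA\<close> many leave \<open>LA\<close> unchanged, one
  raises it by 1, and all the others raise it by 2.\<close>

lemma sum_LA_insert_max:
  fixes f :: "nat \<Rightarrow> 'a::comm_ring_1"
  assumes "distinct xs" "\<forall>z\<in>set xs. z < M"
  shows "(\<Sum>i\<le>length xs. f (LA (insert_at M i xs)))
         = of_nat (LA xs) * f (LA xs) + f (LA xs + 1) + (of_nat (length xs) - of_nat (LA xs)) * f (LA xs + 2)"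
proof (cases xs)
  case Nil
  then show ?thesis using LA_eq_turns[of M "[]"] by (simp add: LA_Nil)
next
  case (Cons x ys)
  have d: "distinct (M # x # ys)" using assms Cons by auto
  have "distinct (x # insert_at M i ys)" if "i \<le> length ys" for i
  proof -
    have "mset (x # insert_at M i ys) = mset (M # x # ys)"
      using mset_append[of "take i ys" "drop i ys"] by (simp add: insert_at_def)
    then show ?thesis using d mset_eq_imp_distinct_iff by blast
  qed
  then have L: "LA (x # insert_at M i ys) = Suc (turns True x (insert_at M i ys))" if "i \<le> length ys" for i
    using LA_eq_turns that by blast
  have "\<not> step True M x" using assms Cons by (auto simp: step_def)
  then have L0: "LA (M # x # ys) = Suc (Suc (turns False x ys))"
    using LA_eq_turns[OF d] by simp
  have L1: "LA (x # ys) = Suc (turns True x ys)" using LA_eq_turns d by simp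
  have "(\<Sum>i\<le>length xs. f (LA (insert_at M i xs)))
     = f (LA (M # x # ys)) + (\<Sum>i\<le>length ys. f (LA (x # insert_at M i ys)))"
    by (simp add: Cons sum.atMost_Suc_shift del: sum.atMost_Suc)
  also have "\<dots> = f (Suc (Suc (turns False x ys))) + (\<Sum>i\<le>length ys. f (Suc (turns True x (insert_at M i ys))))"
    by (simp add: L L0)
  also have "\<dots> = (let k = turns True x ys in of_nat (Suc k) * f (Suc k) + f (Suc (k + 1))
              + (of_nat (length ys) - of_nat k) * f (Suc (k + 2)))"
    using sum_turns_insert_max(1)[of x ys M "\<lambda>k. f (Suc k)"] assms Cons by simp
  finally show ?thesis by (simp add: Cons L1 Let_def)
qed

text \<open>Deleting the maximum and remembering its position is a bijection.\<close>

lemma sum_permutations_of_set_insert: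
  assumes "finite A" "M \<notin> A"
  shows "(\<Sum>xs\<in>permutations_of_set (insert M A). F xs)
       = (\<Sum>xs\<in>permutations_of_set A. \<Sum>i\<le>length xs. F (insert_at M i xs))"
proof -
  let ?S = "SIGMA xs:permutations_of_set A. {..length xs}"
  have "bij_betw (\<lambda>(xs, i). insert_at M i xs) ?S (permutations_of_set (insert M A))"
    unfolding bij_betw_def
  proof
    show "inj_on (\<lambda>(xs, i). insert_at M i xs) ?S"
    proof (rule inj_onI, clarify)
      fix xs i ys j
      assume xs: "xs \<in> permutations_of_set A" "i \<le> length xs"
        and ys: "ys \<in> permutations_of_set A" "j \<le> length ys"
        and eq: "insert_at M i xs = insert_at M j ys"
      have "M \<notin> set (take i xs)" "M \<notin> set (take j ys)" "M \<notin> set (drop i xs)" "M \<notin> set (drop j ys)"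
        using assms(2) permutations_of_setD(1)[OF xs(1)] permutations_of_setD(1)[OF ys(1)]
        by (auto dest: in_set_takeD in_set_dropD)
      then have "take i xs = take j ys \<and> drop i xs = drop j ys"
        using eq unfolding insert_at_def
        by (metis append_Cons_eq_iff)
      then show "xs = ys \<and> i = j"
        using xs ys by (metis append_take_drop_id length_take min.absorb2)
    qed
    show "(\<lambda>(xs, i). insert_at M i xs) ` ?S = permutations_of_set (insert M A)"
    proof (intro equalityI subsetI)
      fix zs assume "zs \<in> (\<lambda>(xs, i). insert_at M i xs) ` ?S"
      then obtain xs i where zs: "zs = insert_at M i xs" "xs \<in> permutations_of_set A" by auto
      have "mset zs = mset (M # xs)"
        using mset_append[of "take i xs" "drop i xs"] by (simp add: zs(1) insert_at_def)
      then have "set zs = insert M (set xs)" "distinct zs \<longleftrightarrow> distinct (M # xs)"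
        using mset_eq_setD[of zs "M # xs"] mset_eq_imp_distinct_iff[of zs "M # xs"] by simp_all
      then show "zs \<in> permutations_of_set (insert M A)"
        using zs(2) assms by (auto simp: permutations_of_set_def)
    next
      fix zs assume zs: "zs \<in> permutations_of_set (insert M A)"
      then have "M \<in> set zs" by (auto dest: permutations_of_setD)
      then obtain us vs where "zs = us @ M # vs" by (auto simp: in_set_conv_decomp)
      then have "zs = insert_at M (length us) (us @ vs)" "us @ vs \<in> permutations_of_set A"
        using zs assms by (auto simp: insert_at_def permutations_of_set_def)
      then show "zs \<in> (\<lambda>(xs, i). insert_at M i xs) ` ?S"
        by (intro image_eqI[of _ _ "(us @ vs, length us)"]) auto
    qed
  qed
  then have "(\<Sum>xs\<in>permutations_of_set (insert M A). F xs) = (\<Sum>(xs, i)\<in>?S. F (insert_at M i xs))"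
    by (simp add: sum.reindex_bij_betw[symmetric] case_prod_beta')
  then show ?thesis by (simp add: sum.Sigma)
qed

text \<open>Up to the factor \<open>n!\<close> this is the expectation of \<open>f (LA)\<close> for a uniformly random permutation. The
  values are taken in a general ring so that both moments (\<open>f\<close> real) and the generating polynomial
  (\<open>f k = X\<^sup>k\<close>) are instances.\<close>

definition LA_sum :: "nat \<Rightarrow> (nat \<Rightarrow> 'a::comm_ring_1) \<Rightarrow> 'a" where
  "LA_sum n f = (\<Sum>xs\<in>permutations_of_set (real ` {1..n}). f (LA xs))"

lemma LA_sum_0: "LA_sum 0 f = f 0"
  by (simp add: LA_sum_def LA_Nil)

text \<open>The law of \<open>LA\<close> evolves as a Markov chain in \<open>n\<close>; everything about the distribution of \<open>LA\<close> that
  is needed below comes from this recurrence.\<close>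

lemma LA_sum_Suc:
  "LA_sum (Suc n) f = LA_sum n (\<lambda>k. of_nat k * f k + f (k + 1) + (of_nat n - of_nat k) * f (k + 2))"
proof -
  let ?A = "real ` {1..n}"
  have e: "real ` {1..Suc n} = insert (real (Suc n)) ?A"
    by (simp add: atLeastAtMostSuc_conv)
  have "(\<Sum>i\<le>length xs. f (LA (insert_at (real (Suc n)) i xs)))
      = of_nat (LA xs) * f (LA xs) + f (LA xs + 1) + (of_nat n - of_nat (LA xs)) * f (LA xs + 2)"
    if "xs \<in> permutations_of_set ?A" for xs
  proof -
    have "length xs = n" using length_finite_permutations_of_set[OF that] by (simp add: card_image)
    then show ?thesis
      using sum_LA_insert_max[of xs "real (Suc n)" f] permutations_of_setD[OF that] by auto
  qed
  then show ?thesis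
    unfolding LA_sum_def e by (subst sum_permutations_of_set_insert) auto
qed

lemma LA_sum_perm:
  "(\<Sum>\<pi> | \<pi> permutes {1..n}. f (LA_perm n \<pi>)) = LA_sum n f"
proof -
  let ?g = "\<lambda>\<pi>. map (\<lambda>i. real (\<pi> i)) [1..<Suc n]"
  have "bij_betw ?g {\<pi>. \<pi> permutes {1..n}} (permutations_of_set (real ` {1..n}))"
    unfolding bij_betw_def
  proof
    show inj: "inj_on ?g {\<pi>. \<pi> permutes {1..n}}"
    proof (rule inj_onI, clarify)
      fix p q assume p: "p permutes {1..n}" "q permutes {1..n}" and eq: "?g p = ?g q"
      show "p = q"
      proof
        fix i
        show "p i = q i"
          using eq p by (cases "i \<in> {1..n}") (auto simp: permutes_not_in simp del: upt_Suc)
      qed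
    qed
    have "?g ` {\<pi>. \<pi> permutes {1..n}} \<subseteq> permutations_of_set (real ` {1..n})"
    proof clarify
      fix p assume p: "p permutes {1..n}"
      have "set (?g p) = real ` p ` {1..n}" by (auto simp del: upt_Suc)
      moreover have "distinct (?g p)"
        using permutes_inj_on[OF p] by (auto simp: distinct_map inj_on_def simp del: upt_Suc)
      ultimately show "?g p \<in> permutations_of_set (real ` {1..n})"
        using permutes_image[OF p] by (metis permutations_of_setI)
    qed
    then show "?g ` {\<pi>. \<pi> permutes {1..n}} = permutations_of_set (real ` {1..n})"
      by (rule card_subset_eq[rotated])
        (use card_image[OF inj] card_permutations[of "{1..n}" n] in
          \<open>simp_all add: card_image del: upt_Suc\<close>)
  qed
  then show ?thesis
    unfolding LA_sum_def LA_perm_def by (rule sum.reindex_bij_betw)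
qed

section \<open>Polynomials without zeros off the nonpositive axis\<close>

text \<open>The logarithmic derivative \<open>P'/P = \<Sum> 1/(z - r)\<close>, recentred at the point 1 through
  \<open>(1 - z)/(z - r) + 1 = (1 - r)/(z - r)\<close>.\<close>

lemma pderiv_linear_factors_eval:
  fixes z :: complex
  assumes "\<forall>r\<in>#A. z \<noteq> r"
  shows "(1 - z) * poly (pderiv (\<Prod>r\<in>#A. [:-r, 1:])) z + of_nat (size A) * poly (\<Prod>r\<in>#A. [:-r, 1:]) z
       = poly (\<Prod>r\<in>#A. [:-r, 1:]) z * (\<Sum>r\<in>#A. (1 - r) / (z - r))"
  using assms
proof (induction A)
  case empty
  then show ?case by (simp add: pderiv_1)
next
  case (add r A)
  define P where "P = (\<Prod>r\<in>#A. [:-r, 1:])"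
  define Q where "Q = poly P z"
  define W where "W = (\<Sum>r\<in>#A. (1 - r) / (z - r))"
  have zr: "z - r \<noteq> 0" and IH: "(1 - z) * poly (pderiv P) z + of_nat (size A) * Q = Q * W"
    using add by (auto simp: P_def Q_def W_def)
  have "(1 - z) * poly (pderiv ([:-r, 1:] * P)) z + of_nat (Suc (size A)) * poly ([:-r, 1:] * P) z
     = (z - r) * ((1 - z) * poly (pderiv P) z + of_nat (size A) * Q) + (1 - z) * Q + (z - r) * Q"
    by (simp only: pderiv_mult) (simp add: pderiv_pCons Q_def algebra_simps)
  also have "\<dots> = (z - r) * Q * W + Q * (1 - r)"
    unfolding IH by (simp add: algebra_simps)
  also have "\<dots> = poly ([:-r, 1:] * P) z * ((1 - r) / (z - r) + W)"
    using zr by (simp add: Q_def field_simps)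
  finally show ?case by (simp add: P_def W_def)
qed

lemma Re_csqrt_pos: "z \<notin> \<real>\<^sub>\<le>\<^sub>0 \<Longrightarrow> Re (csqrt z) > 0"
proof (rule ccontr)
  assume z: "z \<notin> \<real>\<^sub>\<le>\<^sub>0" and "\<not> Re (csqrt z) > 0"
  then have "Re (csqrt z) = 0" using csqrt_principal[of z] by auto
  then have "Re ((csqrt z)\<^sup>2) \<le> 0 \<and> Im ((csqrt z)\<^sup>2) = 0" by (simp add: power2_eq_square)
  then show False using z by (simp add: complex_nonpos_Reals_iff)
qed

text \<open>For \<open>z\<close> off the nonpositive axis and \<open>r \<le> 0\<close> the argument of \<open>z - r\<close> lies between 0 and that of
  \<open>z\<close>, so after multiplication by the square root of \<open>z\<close> all the numbers \<open>1/(z - r)\<close> lie in the right half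
  plane. Hence no combination of them with positive coefficients vanishes.\<close>

lemma Re_csqrt_div_pos:
  assumes "z \<notin> \<real>\<^sub>\<le>\<^sub>0" "r \<in> \<real>\<^sub>\<le>\<^sub>0"
  shows "Re (csqrt z / (z - r)) > 0"
proof -
  define s where "s = csqrt z"
  have s: "s ^ 2 = z" "Re s > 0" using Re_csqrt_pos[OF assms(1)] by (auto simp: s_def)
  obtain \<rho> where \<rho>: "r = - complex_of_real \<rho>" "\<rho> \<ge> 0"
    using assms(2) by (elim nonpos_Reals_cases) (metis add.inverse_inverse neg_0_le_iff_le of_real_minus)
  have nz: "s ^ 2 + of_real \<rho> \<noteq> 0"
  proof
    assume "s ^ 2 + of_real \<rho> = 0"
    then have "z = r" using s \<rho> by (simp add: add_eq_0_iff2)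
    then show False using assms by simp
  qed
  have "s * cnj (s ^ 2 + of_real \<rho>) = (s * cnj s) * cnj s + of_real \<rho> * s"
    by (simp add: power2_eq_square algebra_simps)
  also have "\<dots> = of_real ((cmod s)\<^sup>2) * cnj s + of_real \<rho> * s"
    by (simp only: complex_norm_square)
  finally have "Re (s * cnj (s ^ 2 + of_real \<rho>)) = Re s * ((cmod s)\<^sup>2 + \<rho>)"
    by (simp only: plus_complex.sel times_complex.sel Re_complex_of_real Im_complex_of_real complex_cnj)
      (simp add: algebra_simps)
  also have "\<dots> > 0" using s \<rho> by (intro mult_pos_pos add_pos_nonneg) auto
  finally have "Re (s * cnj (s ^ 2 + of_real \<rho>)) > 0" .
  moreover have "z - r = s ^ 2 + of_real \<rho>" using s \<rho> by simp
  ultimately show ?thesis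
    using nz unfolding s_def[symmetric]
    by (subst complex_div_cnj) (simp add: Re_divide_of_real)
qed

text \<open>The polar derivative \<open>(1 - z) p' + N p\<close> of a polynomial of degree at most \<open>N\<close> with respect to the
  point 1 is \<open>p\<close> times a positive combination of the numbers \<open>1/(z - r)\<close>, up to a nonnegative constant
  \<open>N - degree p\<close>. This is the mechanism of Laguerre's theorem.\<close>

lemma polar_derivative_eval:
  fixes p :: "complex poly"
  assumes deg: "degree p \<le> N" and roots: "\<And>z. z \<notin> \<real>\<^sub>\<le>\<^sub>0 \<Longrightarrow> poly p z \<noteq> 0" and z: "z \<notin> \<real>\<^sub>\<le>\<^sub>0"
  shows "\<exists>w. (1 - z) * poly (pderiv p) z + of_nat N * poly p z = poly p z * w
             \<and> Re (csqrt z * w) \<ge> 0 \<and> (N > 0 \<longrightarrow> Re (csqrt z * w) > 0)"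
proof -
  have p0: "p \<noteq> 0" using roots[of 1] by auto
  then obtain A where A: "size A = degree p" "p = smult (lead_coeff p) (\<Prod>r\<in>#A. [:-r, 1:])"
    using alg_closed_imp_factorization[OF p0] by (elim exE conjE) (rule that)
  define c P where "c = lead_coeff p" and "P = (\<Prod>r\<in>#A. [:-r, 1:])"
  have p: "p = smult c P" unfolding c_def P_def by (rule A(2))
  have roots_A: "r \<in> \<real>\<^sub>\<le>\<^sub>0" if "r \<in># A" for r
  proof -
    have "poly P r = 0" using that by (auto simp: P_def poly_prod_mset image_iff)
    then show ?thesis using roots[of r] p by auto
  qed
  define w where "w = (\<Sum>r\<in>#A. (1 - r) / (z - r)) + of_nat (N - degree p)"
  have zA: "\<forall>r\<in>#A. z \<noteq> r" using roots_A z by auto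
  have N: "of_nat N = (of_nat (size A) + of_nat (N - degree p) :: complex)"
    using deg A by (simp flip: of_nat_add)
  have eq: "(1 - z) * poly (pderiv p) z + of_nat N * poly p z = poly p z * w"
  proof -
    have "(1 - z) * poly (pderiv p) z + of_nat N * poly p z
      = c * ((1 - z) * poly (pderiv P) z + of_nat (size A) * poly P z) + of_nat (N - degree p) * poly p z"
      unfolding N by (simp add: p pderiv_smult algebra_simps)
    also have "\<dots> = poly p z * w"
      unfolding pderiv_linear_factors_eval[OF zA, folded P_def] by (simp add: p w_def algebra_simps)
    finally show ?thesis .
  qed
  have term_pos: "Re (csqrt z * ((1 - r) / (z - r))) > 0" if r: "r \<in># A" for r
  proof -
    obtain \<rho> where \<rho>: "r = complex_of_real \<rho>" "\<rho> \<le> 0"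
      using roots_A[OF r] by (auto elim: nonpos_Reals_cases)
    have "csqrt z * ((1 - r) / (z - r)) = of_real (1 - \<rho>) * (csqrt z / (z - r))"
      by (simp add: \<rho>)
    then have "Re (csqrt z * ((1 - r) / (z - r))) = (1 - \<rho>) * Re (csqrt z / (z - r))"
      by (simp only: Re_complex_of_real Im_complex_of_real times_complex.sel mult_zero_left diff_zero)
    then show ?thesis using Re_csqrt_div_pos[OF z roots_A[OF r]] \<rho> by simp
  qed
  have sum_pos: "Re (csqrt z * (\<Sum>r\<in>#B. (1 - r) / (z - r))) \<ge> 0 \<and>
      (B \<noteq> {#} \<longrightarrow> Re (csqrt z * (\<Sum>r\<in>#B. (1 - r) / (z - r))) > 0)" if "B \<subseteq># A" for B
    using that
  proof (induction B)
    case (add r B)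
    have "r \<in># A" "B \<subseteq># A" using add.prems by (auto dest: mset_subset_eq_insertD simp: subset_mset.less_imp_le)
    then show ?case using add.IH term_pos[of r] by (simp add: distrib_left del: times_complex.sel csqrt.simps)
  qed simp
  have "Re (csqrt z * w) = Re (csqrt z * (\<Sum>r\<in>#A. (1 - r) / (z - r))) + Re (csqrt z) * real (N - degree p)"
    by (simp add: w_def distrib_left)
  moreover have "N - degree p > 0" if "A = {#}" "N > 0" using that A by auto
  ultimately have "Re (csqrt z * w) \<ge> 0 \<and> (N > 0 \<longrightarrow> Re (csqrt z * w) > 0)"
    using sum_pos[of A] Re_csqrt_pos[OF z] 
    by (cases "A = {#}") (auto simp del: times_complex.sel csqrt.simps intro: add_pos_nonneg)
  with eq show ?thesis by blast
qed

lemma nonvanishing_even_step: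
  fixes p :: "complex poly"
  assumes "degree p \<le> Suc N" "\<And>z. z \<notin> \<real>\<^sub>\<le>\<^sub>0 \<Longrightarrow> poly p z \<noteq> 0" "z \<notin> \<real>\<^sub>\<le>\<^sub>0"
  shows "poly ([:0, 1, -1:] * pderiv p + [:0, of_nat (Suc N):] * p) z \<noteq> 0"
proof -
  obtain w where w: "(1 - z) * poly (pderiv p) z + of_nat (Suc N) * poly p z = poly p z * w"
    "Re (csqrt z * w) > 0"
    using polar_derivative_eval[OF assms] by blast
  have "poly ([:0, 1, -1:] * pderiv p + [:0, of_nat (Suc N):] * p) z
      = z * ((1 - z) * poly (pderiv p) z + of_nat (Suc N) * poly p z)"
    by (simp add: algebra_simps)
  moreover have "w \<noteq> 0" "z \<noteq> 0" using w assms(3) by auto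
  ultimately show ?thesis using w assms(2,3) by simp
qed

text \<open>The operator equals \<open>z ((1 + z) ((1 - z) p' + N p) + p)\<close>: besides the polar derivative there is the
  term \<open>1/(1 + z)\<close>, which is the contribution of a further zero at \<open>-1\<close>.\<close>

lemma nonvanishing_odd_step:
  fixes p :: "complex poly"
  assumes "degree p \<le> N" "\<And>z. z \<notin> \<real>\<^sub>\<le>\<^sub>0 \<Longrightarrow> poly p z \<noteq> 0" "z \<notin> \<real>\<^sub>\<le>\<^sub>0"
  shows "poly ([:0, 1, 0, -1:] * pderiv p + [:0, of_nat (Suc N), of_nat N:] * p) z \<noteq> 0"
proof -
  obtain w where w: "(1 - z) * poly (pderiv p) z + of_nat N * poly p z = poly p z * w"
    "Re (csqrt z * w) \<ge> 0"
    using polar_derivative_eval[OF assms] by blast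
  have m1: "(-1 :: complex) \<in> \<real>\<^sub>\<le>\<^sub>0" by simp
  then have z1: "1 + z \<noteq> 0" using assms(3) by (metis add_eq_0_iff)
  have "poly ([:0, 1, 0, -1:] * pderiv p + [:0, of_nat (Suc N), of_nat N:] * p) z
      = z * ((1 + z) * ((1 - z) * poly (pderiv p) z + of_nat N * poly p z) + poly p z)"
    by (simp add: algebra_simps)
  also have "\<dots> = z * poly p z * (1 + z) * (w + 1 / (1 + z))"
    unfolding w(1) using z1 by (simp add: field_simps)
  finally have eq: "poly ([:0, 1, 0, -1:] * pderiv p + [:0, of_nat (Suc N), of_nat N:] * p) z
      = z * poly p z * (1 + z) * (w + 1 / (1 + z))" .
  have "csqrt z * (w + 1 / (1 + z)) = csqrt z * w + csqrt z / (z - (-1))"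
    by (simp add: distrib_left add.commute)
  then have "Re (csqrt z * (w + 1 / (1 + z))) > 0"
    using w(2) Re_csqrt_div_pos[OF assms(3) m1] by (simp del: times_complex.sel csqrt.simps)
  then have "w + 1 / (1 + z) \<noteq> 0"
    by (metis less_irrefl mult_zero_right zero_complex.sel(1))
  moreover have "z \<noteq> 0" using assms(3) by auto
  ultimately show ?thesis using eq z1 assms(2,3) by simp
qed

text \<open>The coefficient in the next higher degree cancels; this keeps the degree within the bound required
  by the polar derivative.\<close>

lemma degree_even_step:
  fixes p :: "complex poly"
  assumes "degree p \<le> Suc N"
  shows "degree ([:0, 1, -1:] * pderiv p + [:0, of_nat (Suc N):] * p) \<le> Suc N"
proof (rule degree_le, intro allI impI)
  fix i assume "Suc N < i"
  then obtain j where i: "i = Suc (Suc j)" "N \<le> j" by (cases i; cases "i - 1") auto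
  have "coeff p (Suc (Suc j)) = 0" using assms i by (intro coeff_eq_0) simp
  moreover have "coeff p (Suc j) = 0 \<or> j = N" using assms i by (cases "j = N") (auto intro!: coeff_eq_0)
  ultimately show "coeff ([:0, 1, -1:] * pderiv p + [:0, of_nat (Suc N):] * p) i = 0"
    by (auto simp: i coeff_pderiv algebra_simps)
qed

lemma degree_odd_step:
  fixes p :: "complex poly"
  assumes "degree p \<le> N"
  shows "degree ([:0, 1, 0, -1:] * pderiv p + [:0, of_nat (Suc N), of_nat N:] * p) \<le> Suc N"
proof (rule degree_le, intro allI impI)
  fix i assume "Suc N < i"
  then obtain j where i: "i = Suc (Suc j)" "N \<le> j" by (cases i; cases "i - 1") auto
  have "coeff p (Suc (Suc j)) = 0" "coeff p (Suc j) = 0" using assms i by (auto intro!: coeff_eq_0)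
  moreover have "coeff p j = 0 \<or> j = N" using assms i by (cases "j = N") (auto intro!: coeff_eq_0)
  ultimately show "coeff ([:0, 1, 0, -1:] * pderiv p + [:0, of_nat (Suc N), of_nat N:] * p) i = 0"
    by (cases j) (auto simp: i coeff_pderiv algebra_simps)
qed

text \<open>A factor \<open>X - x\<close> with \<open>x \<le> 0\<close> is a multiple of \<open>(1 - q) + q X\<close> with \<open>q = 1/(1 - x)\<close>, the probability
  generating function of a Bernoulli variable.\<close>

lemma nonpos_roots_imp_binomial_factors:
  fixes p :: "complex poly"
  assumes "\<And>z. z \<notin> \<real>\<^sub>\<le>\<^sub>0 \<Longrightarrow> poly p z \<noteq> 0"
  shows "\<exists>qs :: real list. set qs \<subseteq> {0..1} \<and>
     p = smult (poly p 1) (\<Prod>q\<leftarrow>qs. [:1 - complex_of_real q, complex_of_real q:])"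
proof -
  have p0: "p \<noteq> 0" using assms[of 1] by auto
  then obtain A where A: "p = smult (lead_coeff p) (\<Prod>r\<in>#A. [:-r, 1:])"
    using alg_closed_imp_factorization[OF p0] by (elim exE conjE) (rule that)
  obtain rs where rs: "A = mset rs" by (metis ex_mset)
  have roots: "set rs \<subseteq> \<real>\<^sub>\<le>\<^sub>0"
  proof
    fix r assume "r \<in> set rs"
    then have "poly p r = 0" by (subst A) (auto simp: poly_prod_mset image_iff rs)
    then show "r \<in> \<real>\<^sub>\<le>\<^sub>0" using assms by auto
  qed
  have "\<exists>c. \<exists>qs. set qs \<subseteq> {0..1} \<and>
     (\<Prod>r\<leftarrow>rs. [:-r, 1:]) = smult c (\<Prod>q\<leftarrow>qs. [:1 - complex_of_real q, complex_of_real q:])"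
    using roots
  proof (induction rs)
    case Nil
    then show ?case by (intro exI[of _ 1] exI[of _ "[]"]) simp
  next
    case (Cons r rs)
    then obtain c qs where qs: "set qs \<subseteq> {0..1}"
      "(\<Prod>r\<leftarrow>rs. [:-r, 1:]) = smult c (\<Prod>q\<leftarrow>qs. [:1 - complex_of_real q, complex_of_real q:])" by auto
    obtain x where x: "r = complex_of_real x" "x \<le> 0"
      using Cons.prems by (auto elim: nonpos_Reals_cases)
    define q where "q = 1 / (1 - x)"
    have q: "q \<in> {0..1}" "q \<noteq> 0" "x = (q - 1) / q" using x(2) by (auto simp: q_def field_simps)
    have "[:-r, 1:] = smult (of_real (1 / q)) [:1 - complex_of_real q, complex_of_real q:]"
      using q by (simp add: x(1)) (simp add: q(3) field_simps)
    then have "(\<Prod>r\<leftarrow>r # rs. [:-r, 1:]) = smult (of_real (1 / q)) [:1 - complex_of_real q, complex_of_real q:]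
        * smult c (\<Prod>q\<leftarrow>qs. [:1 - complex_of_real q, complex_of_real q:])"
      using qs(2) by (simp only: list.map prod_list.Cons)
    then have "(\<Prod>r\<leftarrow>r # rs. [:-r, 1:]) = smult (of_real (1 / q) * c)
        (\<Prod>q\<leftarrow>q # qs. [:1 - complex_of_real q, complex_of_real q:])"
      by (simp only: list.map prod_list.Cons mult_smult_left mult_smult_right smult_smult mult.commute)
    then show ?case using qs(1) q(1)
      by (intro exI[of _ "of_real (1 / q) * c"] exI[of _ "q # qs"]) simp
  qed
  then obtain c qs where qs: "set qs \<subseteq> {0..1}"
     "(\<Prod>r\<leftarrow>rs. [:-r, 1:]) = smult c (\<Prod>q\<leftarrow>qs. [:1 - complex_of_real q, complex_of_real q:])" by auto
  have p: "p = smult (lead_coeff p * c) (\<Prod>q\<leftarrow>qs. [:1 - complex_of_real q, complex_of_real q:])"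
  proof -
    have "(\<Prod>r\<in>#A. [:-r, 1:]) = smult c (\<Prod>q\<leftarrow>qs. [:1 - complex_of_real q, complex_of_real q:])"
      unfolding qs(2)[symmetric] rs mset_map[symmetric] prod_mset_prod_list ..
    from A[unfolded this smult_smult] show ?thesis .
  qed
  have "poly (\<Prod>q\<leftarrow>qs. [:1 - complex_of_real q, complex_of_real q:]) 1 = 1"
    by (induction qs) simp_all
  then have "poly p 1 = lead_coeff p * c" by (subst p) simp
  then have "p = smult (poly p 1) (\<Prod>q\<leftarrow>qs. [:1 - complex_of_real q, complex_of_real q:])"
    using p by (simp only:)
  then show ?thesis using qs(1) by blast
qed

section \<open>Sums of independent Bernoulli variables\<close>

text \<open>The expectation of \<open>f\<close> at a sum of independent Bernoulli variables with the given success
  probabilities (a Poisson binomial variable), obtained by conditioning on one variable after another.\<close>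

fun pb_expect :: "real list \<Rightarrow> (nat \<Rightarrow> real) \<Rightarrow> real" where
  "pb_expect [] f = f 0"
| "pb_expect (q # qs) f = (1 - q) * pb_expect qs f + q * pb_expect qs (\<lambda>k. f (Suc k))"

text \<open>The functional \<open>\<Sum>\<^sub>i q\<^sub>i (1 - q\<^sub>i) E g(S - X\<^sub>i)\<close>: the variance times the expectation under a discrete
  zero-bias law of \<open>S\<close>. The recursion separates the summand belonging to the first variable.\<close>

fun pb_zero_bias :: "real list \<Rightarrow> (nat \<Rightarrow> real) \<Rightarrow> real" where
  "pb_zero_bias [] g = 0"
| "pb_zero_bias (q # qs) g = q * (1 - q) * pb_expect qs g
     + (1 - q) * pb_zero_bias qs g + q * pb_zero_bias qs (\<lambda>k. g (Suc k))"

definition pb_mean :: "real list \<Rightarrow> real" where "pb_mean qs = sum_list qs"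
definition pb_var :: "real list \<Rightarrow> real" where "pb_var qs = (\<Sum>q\<leftarrow>qs. q * (1 - q))"

lemma pb_expect_add: "pb_expect qs (\<lambda>k. f k + g k) = pb_expect qs f + pb_expect qs g"
  by (induction qs arbitrary: f g) (simp_all add: algebra_simps)

lemma pb_expect_cmult: "pb_expect qs (\<lambda>k. c * f k) = c * pb_expect qs f"
  by (induction qs arbitrary: f) (simp_all add: algebra_simps)

lemma pb_expect_diff: "pb_expect qs (\<lambda>k. f k - g k) = pb_expect qs f - pb_expect qs g"
  using pb_expect_add[of qs f "\<lambda>k. - 1 * g k"] unfolding pb_expect_cmult by simp

lemma pb_expect_const [simp]: "pb_expect qs (\<lambda>k. c) = c"
  by (induction qs) (simp_all add: algebra_simps)

lemma pb_expect_mono: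
  "set qs \<subseteq> {0..1} \<Longrightarrow> (\<And>k. f k \<le> g k) \<Longrightarrow> pb_expect qs f \<le> pb_expect qs g"
  by (induction qs arbitrary: f g) (auto intro!: add_mono mult_left_mono)

lemma pb_zero_bias_const: "pb_zero_bias qs (\<lambda>k. c) = c * pb_var qs"
  by (induction qs) (simp_all add: algebra_simps pb_var_def)

lemma pb_zero_bias_cmult: "pb_zero_bias qs (\<lambda>k. c * f k) = c * pb_zero_bias qs f"
  by (induction qs arbitrary: f) (simp_all add: algebra_simps pb_expect_cmult)

text \<open>The discrete counterpart of Gaussian integration by parts: conditionally on the other variables,
  \<open>E (X\<^sub>i - q\<^sub>i) f(S) = q\<^sub>i (1 - q\<^sub>i) (f(S - X\<^sub>i + 1) - f(S - X\<^sub>i))\<close>.\<close>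

lemma pb_covariance_identity:
  "pb_expect qs (\<lambda>k. (real k - pb_mean qs) * f k) = pb_zero_bias qs (\<lambda>k. f (Suc k) - f k)"
proof (induction qs arbitrary: f)
  case Nil
  then show ?case by (simp add: pb_mean_def)
next
  case (Cons q qs)
  let ?m = "pb_mean qs"
  have 1: "pb_expect qs (\<lambda>k. (real k - pb_mean (q # qs)) * f k)
      = pb_zero_bias qs (\<lambda>k. f (Suc k) - f k) - q * pb_expect qs f"
  proof -
    have "(\<lambda>k. (real k - pb_mean (q # qs)) * f k) = (\<lambda>k. (real k - ?m) * f k - q * f k)"
      by (auto simp: pb_mean_def algebra_simps)
    then show ?thesis by (simp only: pb_expect_diff pb_expect_cmult Cons.IH)
  qed
  have 2: "pb_expect qs (\<lambda>k. (real (Suc k) - pb_mean (q # qs)) * f (Suc k))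
      = pb_zero_bias qs (\<lambda>k. f (Suc (Suc k)) - f (Suc k)) + (1 - q) * pb_expect qs (\<lambda>k. f (Suc k))"
  proof -
    have "(\<lambda>k. (real (Suc k) - pb_mean (q # qs)) * f (Suc k))
        = (\<lambda>k. (real k - ?m) * f (Suc k) + (1 - q) * f (Suc k))"
      by (auto simp: pb_mean_def algebra_simps)
    then show ?thesis by (simp only: pb_expect_add pb_expect_cmult Cons.IH)
  qed
  show ?case
    by (simp only: pb_expect.simps pb_zero_bias.simps 1 2 pb_expect_diff) (simp add: algebra_simps)
qed

lemma pb_variance: "pb_expect qs (\<lambda>k. (real k - pb_mean qs)\<^sup>2) = pb_var qs"
proof -
  have "pb_expect qs (\<lambda>k. (real k - pb_mean qs) * (real k - pb_mean qs))
      = pb_zero_bias qs (\<lambda>k. (real (Suc k) - pb_mean qs) - (real k - pb_mean qs))"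
    by (rule pb_covariance_identity)
  then show ?thesis by (simp add: power2_eq_square pb_zero_bias_const)
qed

lemma pb_mean: "pb_expect qs real = pb_mean qs"
proof -
  have "pb_expect qs (\<lambda>k. (real k - pb_mean qs) * 1) = 0"
    using pb_covariance_identity[of qs "\<lambda>k. 1"] pb_zero_bias_const[of qs 0] by simp
  then show ?thesis by (simp add: pb_expect_diff)
qed

text \<open>\<open>S\<close> itself is \<open>S - X\<^sub>i\<close> or \<open>S - X\<^sub>i + 1\<close>, which is why \<open>h\<close> has to dominate at both of these places.
  This lets expectations under the zero-bias law be compared with expectations under the law of \<open>S\<close>.\<close>

lemma pb_zero_bias_le:
  assumes "set qs \<subseteq> {0..1}" "\<And>k. g k \<le> h k" "\<And>k. g k \<le> h (Suc k)"
  shows "pb_zero_bias qs g \<le> pb_var qs * pb_expect qs h"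
  using assms
proof (induction qs arbitrary: g h)
  case Nil
  then show ?case by (simp add: pb_var_def)
next
  case (Cons q qs)
  have q: "0 \<le> q" "q \<le> 1" and qs: "set qs \<subseteq> {0..1}" using Cons.prems by auto
  have "pb_expect qs g \<le> pb_expect qs h" "pb_expect qs g \<le> pb_expect qs (\<lambda>k. h (Suc k))"
    using Cons.prems qs by (auto intro!: pb_expect_mono)
  then have "(1 - q) * pb_expect qs g + q * pb_expect qs g
      \<le> (1 - q) * pb_expect qs h + q * pb_expect qs (\<lambda>k. h (Suc k))"
    using q by (intro add_mono mult_left_mono) auto
  then have "pb_expect qs g \<le> pb_expect (q # qs) h" by (simp add: algebra_simps)
  then have "q * (1 - q) * pb_expect qs g \<le> q * (1 - q) * pb_expect (q # qs) h"
    using q by (intro mult_left_mono) auto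
  moreover have "(1 - q) * pb_zero_bias qs g \<le> (1 - q) * (pb_var qs * pb_expect qs h)"
    using q Cons.IH[of g h] Cons.prems qs by (intro mult_left_mono) auto
  moreover have "q * pb_zero_bias qs (\<lambda>k. g (Suc k)) \<le> q * (pb_var qs * pb_expect qs (\<lambda>k. h (Suc k)))"
    using q Cons.IH[of "\<lambda>k. g (Suc k)" "\<lambda>k. h (Suc k)"] Cons.prems qs by (intro mult_left_mono) auto
  moreover have var: "pb_var (q # qs) = q * (1 - q) + pb_var qs" by (simp add: pb_var_def)
  have "pb_var (q # qs) * pb_expect (q # qs) h = q * (1 - q) * pb_expect (q # qs) h
      + ((1 - q) * (pb_var qs * pb_expect qs h) + q * (pb_var qs * pb_expect qs (\<lambda>k. h (Suc k))))"
    unfolding var by (simp add: algebra_simps)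
  ultimately show ?case unfolding pb_zero_bias.simps by linarith
qed

lemma pb_zero_bias_ge:
  assumes "set qs \<subseteq> {0..1}" "\<And>k. h k \<le> g k" "\<And>k. h (Suc k) \<le> g k"
  shows "pb_var qs * pb_expect qs h \<le> pb_zero_bias qs g"
  using pb_zero_bias_le[of qs "\<lambda>k. - 1 * g k" "\<lambda>k. - 1 * h k"] assms
  unfolding pb_zero_bias_cmult pb_expect_cmult by simp

lemma pb_abs_moment:
  assumes "set qs \<subseteq> {0..1}" "pb_var qs = \<sigma>\<^sup>2" "\<sigma> > 0"
  shows "pb_expect qs (\<lambda>k. \<bar>real k - pb_mean qs\<bar>) \<le> \<sigma>"
proof -
  have "\<bar>x\<bar> \<le> 1 / (2 * \<sigma>) * (x\<^sup>2 + \<sigma>\<^sup>2)" for x :: real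
  proof -
    have "0 \<le> (\<bar>x\<bar> - \<sigma>)\<^sup>2" by simp
    then have "2 * \<sigma> * \<bar>x\<bar> \<le> x\<^sup>2 + \<sigma>\<^sup>2" by (simp add: power2_diff algebra_simps)
    then show ?thesis using assms(3) by (simp add: field_simps)
  qed
  then have "pb_expect qs (\<lambda>k. \<bar>real k - pb_mean qs\<bar>)
      \<le> pb_expect qs (\<lambda>k. 1 / (2 * \<sigma>) * ((real k - pb_mean qs)\<^sup>2 + \<sigma>\<^sup>2))"
    using assms(1) by (intro pb_expect_mono)
  also have "\<dots> = 1 / (2 * \<sigma>) * (\<sigma>\<^sup>2 + \<sigma>\<^sup>2)"
    by (simp only: pb_expect_cmult pb_expect_add pb_variance assms(2) pb_expect_const)
  also have "\<dots> = \<sigma>" using assms(3) by (simp add: power2_eq_square)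
  finally show ?thesis .
qed

text \<open>The test function is the identity near \<open>m\<close>, cut off at height \<open>r + 1\<close>: its increments are 1 at
  every place that can contribute, while its covariance with \<open>S\<close> is at most the height times \<open>\<sigma>\<close>.\<close>

lemma pb_concentration:
  assumes "set qs \<subseteq> {0..1}" "pb_var qs = \<sigma>\<^sup>2" "\<sigma> > 0" "r \<ge> 0"
  shows "pb_expect qs (\<lambda>k. if \<bar>real k - m\<bar> \<le> r then 1 else 0) \<le> (r + 1) / \<sigma>"
proof -
  \<comment> \<open>one unit of height more than \<open>r\<close>, since the increments at \<open>k\<close> and at \<open>k - 1\<close> both have to be 1\<close>
  define f where "f k = max (- (r + 1)) (min (r + 1) (real k - m))" for k :: nat
  let ?h = "\<lambda>k. if \<bar>real k - m\<bar> \<le> r then 1 else 0 :: real"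
  have "\<sigma>\<^sup>2 * pb_expect qs ?h \<le> pb_zero_bias qs (\<lambda>k. f (Suc k) - f k)"
    unfolding assms(2)[symmetric]
    using assms(1,4) by (intro pb_zero_bias_ge) (auto simp: f_def max_def min_def)
  also have "\<dots> = pb_expect qs (\<lambda>k. (real k - pb_mean qs) * f k)"
    by (rule pb_covariance_identity[symmetric])
  also have "\<dots> \<le> pb_expect qs (\<lambda>k. (r + 1) * \<bar>real k - pb_mean qs\<bar>)"
  proof (rule pb_expect_mono[OF assms(1)])
    fix k
    have "\<bar>f k\<bar> \<le> r + 1" using assms(4) by (auto simp: f_def)
    then have "\<bar>real k - pb_mean qs\<bar> * \<bar>f k\<bar> \<le> \<bar>real k - pb_mean qs\<bar> * (r + 1)"
      by (intro mult_left_mono) auto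
    then show "(real k - pb_mean qs) * f k \<le> (r + 1) * \<bar>real k - pb_mean qs\<bar>"
      by (simp add: abs_mult[symmetric] mult.commute abs_le_iff)
  qed
  also have "\<dots> \<le> (r + 1) * \<sigma>"
    unfolding pb_expect_cmult using pb_abs_moment[OF assms(1-3)] assms(4) by (intro mult_left_mono) auto
  finally have "\<sigma> * (\<sigma> * pb_expect qs ?h) \<le> \<sigma> * (r + 1)" by (simp add: power2_eq_square mult_ac)
  then have "\<sigma> * pb_expect qs ?h \<le> r + 1" using assms(3) by (simp only: mult_le_cancel_left_pos)
  then show ?thesis using assms(3) by (simp add: pos_le_divide_eq mult.commute)
qed


section \<open>Stein's equation for the normal distribution\<close>

abbreviation (input) \<phi> :: "real \<Rightarrow> real" where "\<phi> \<equiv> std_normal_density"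
definition \<Phi> :: "real \<Rightarrow> real" where "\<Phi> = cdf std_normal_distribution"

interpretation std_normal: real_distribution std_normal_distribution
  by (rule real_dist_normal_dist)

lemma \<Phi>_bounds: "0 \<le> \<Phi> x" "\<Phi> x \<le> 1"
  unfolding \<Phi>_def by (rule std_normal.cdf_nonneg std_normal.cdf_bounded_prob)+

lemma \<Phi>_mono: "x \<le> y \<Longrightarrow> \<Phi> x \<le> \<Phi> y"
  unfolding \<Phi>_def by (rule std_normal.cdf_nondecreasing)

lemma \<phi>_pos: "\<phi> x > 0"
  by (simp add: normal_density_pos)

lemma DERIV_\<phi>: "(\<phi> has_real_derivative - x * \<phi> x) (at x)"
  unfolding std_normal_density_def[abs_def]
  by (rule derivative_eq_intros refl | simp)+

text \<open>The measure-theoretic distribution function as a Riemann integral, for differentiation below.\<close>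

lemma \<Phi>_increment:
  assumes "a \<le> x"
  shows "\<Phi> x = \<Phi> a + integral {a..x} \<phi>"
proof (cases "a = x")
  case False
  have cont: "continuous_on {a..x} \<phi>"
    unfolding std_normal_density_def[abs_def] by (intro continuous_intros) simp
  have "\<Phi> x - \<Phi> a = measure std_normal_distribution {a<..x}"
    unfolding \<Phi>_def using False assms by (intro std_normal.cdf_diff_eq) auto
  also have "\<dots> = enn2real (\<integral>\<^sup>+ y. ennreal (\<phi> y) * indicator {a<..x} y \<partial>lborel)"
    by (simp add: measure_def emeasure_density)
  also have "(\<integral>\<^sup>+ y. ennreal (\<phi> y) * indicator {a<..x} y \<partial>lborel)
      = (\<integral>\<^sup>+ y. ennreal (\<phi> y) * indicator {a..x} y \<partial>lborel)"
    using AE_lborel_singleton[of a] by (intro nn_integral_cong_AE) (auto simp: indicator_def)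
  also have "\<dots> = ennreal (integral {a..x} \<phi>)"
  proof -
    have "set_integrable lborel {a..x} \<phi>" by (rule borel_integrable_atLeastAtMost'[OF cont])
    then have int: "integrable lborel (\<lambda>y. indicator {a..x} y *\<^sub>R \<phi> y)"
      and eq: "(\<integral>y. indicator {a..x} y *\<^sub>R \<phi> y \<partial>lborel) = integral {a..x} \<phi>"
      using set_borel_integral_eq_integral(2)[of "{a..x}" \<phi>]
      by (simp_all add: set_integrable_def set_lebesgue_integral_def)
    have "(\<integral>\<^sup>+ y. ennreal (\<phi> y) * indicator {a..x} y \<partial>lborel)
        = (\<integral>\<^sup>+ y. ennreal (indicator {a..x} y *\<^sub>R \<phi> y) \<partial>lborel)"
      by (intro nn_integral_cong) (auto simp: indicator_def)
    also have "\<dots> = ennreal (integral {a..x} \<phi>)"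
      using nn_integral_eq_integral[OF int] eq by simp
    finally show ?thesis .
  qed
  also have "enn2real \<dots> = integral {a..x} \<phi>"
    using cont by (intro enn2real_ennreal integral_nonneg integrable_continuous_real) auto
  finally show ?thesis by simp
qed simp

lemma DERIV_\<Phi>: "(\<Phi> has_real_derivative \<phi> x) (at x)"
proof -
  have cont: "continuous_on {x - 1..x + 1} \<phi>"
    unfolding std_normal_density_def[abs_def] by (intro continuous_intros) simp
  have "((\<lambda>u. integral {x - 1..u} \<phi>) has_real_derivative \<phi> x) (at x within {x - 1..x + 1})"
    using cont by (intro integral_has_real_derivative) auto
  then have "((\<lambda>u. integral {x - 1..u} \<phi>) has_real_derivative \<phi> x) (at x)"
    by (simp add: at_within_interior[of x "{x - 1..x + 1}"])
  then have "((\<lambda>u. \<Phi> (x - 1) + integral {x - 1..u} \<phi>) has_real_derivative \<phi> x) (at x)"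
    by (auto intro!: derivative_eq_intros)
  moreover have "eventually (\<lambda>u. \<Phi> u = \<Phi> (x - 1) + integral {x - 1..u} \<phi>) (nhds x)"
    by (rule eventually_mono[OF eventually_nhds_in_open[of "{x - 1<..}"]]) (auto intro!: \<Phi>_increment)
  ultimately show ?thesis by (subst DERIV_cong_ev[OF refl _ refl])
qed

text \<open>The difference \<open>\<phi>(u)/u - (1 - \<Phi>(u))\<close> decreases to 0 at infinity because its derivative is
  \<open>-\<phi>(u)/u\<^sup>2\<close>.\<close>

lemma mills_upper:
  assumes "x > 0"
  shows "x * (1 - \<Phi> x) \<le> \<phi> x"
proof -
  define g where "g u = \<phi> u / u - (1 - \<Phi> u)" for u
  have "0 < g x"
  proof (rule DERIV_neg_imp_decreasing_at_top[where f = g])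
    fix u assume "x \<le> u"
    then have u: "u > 0" using assms by simp
    have "(g has_real_derivative - \<phi> u / u\<^sup>2) (at u)"
      unfolding g_def using u
      by (auto intro!: derivative_eq_intros DERIV_\<phi> DERIV_\<Phi> simp: field_simps power2_eq_square)
    then show "\<exists>y. (g has_real_derivative y) (at u) \<and> y < 0"
      using u \<phi>_pos[of u] by (intro exI[of _ "- \<phi> u / u\<^sup>2"]) (simp add: field_simps)
  next
    have 1: "((\<lambda>u. \<phi> u / u) \<longlongrightarrow> 0) at_top"
      unfolding std_normal_density_def by real_asymp
    have 2: "(\<Phi> \<longlongrightarrow> 1) at_top" unfolding \<Phi>_def by (rule std_normal.cdf_lim_at_top_prob)
    show "(g \<longlongrightarrow> 0) at_top"
      unfolding g_def using tendsto_diff[OF 1 tendsto_diff[OF tendsto_const 2, of 1]] by simp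
  qed
  then show ?thesis using assms by (simp add: g_def field_simps)
qed

lemma mills_lower:
  assumes "x < 0"
  shows "- x * \<Phi> x \<le> \<phi> x"
proof -
  define g where "g u = - \<phi> u / u - \<Phi> u" for u
  have "0 < g x"
  proof (rule DERIV_pos_imp_increasing_at_bot[where f = g])
    fix u assume "u \<le> x"
    then have u: "u < 0" using assms by simp
    have "(g has_real_derivative \<phi> u / u\<^sup>2) (at u)"
      unfolding g_def using u
      by (auto intro!: derivative_eq_intros DERIV_\<phi> DERIV_\<Phi> simp: field_simps power2_eq_square)
    then show "\<exists>y. (g has_real_derivative y) (at u) \<and> 0 < y"
      using u \<phi>_pos[of u] by (intro exI[of _ "\<phi> u / u\<^sup>2"]) (simp add: field_simps)
  next
    have 1: "((\<lambda>u. - \<phi> u / u) \<longlongrightarrow> 0) at_bot"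
      unfolding std_normal_density_def by real_asymp
    have 2: "(\<Phi> \<longlongrightarrow> 0) at_bot" unfolding \<Phi>_def by (rule std_normal.cdf_lim_at_bot)
    show "(g \<longlongrightarrow> 0) at_bot"
      unfolding g_def using tendsto_diff[OF 1 2] by simp
  qed
  then show ?thesis using assms by (simp add: g_def field_simps)
qed

text \<open>The bounded solution of Stein's equation \<open>f'(w) - w f(w) = 1{w \<le> z} - \<Phi>(z)\<close>; it has a corner at
  \<open>w = z\<close>.\<close>

definition stein :: "real \<Rightarrow> real \<Rightarrow> real" where
  "stein z w = \<Phi> (min w z) * (1 - \<Phi> (max w z)) / \<phi> w"

lemma stein_nonneg: "stein z w \<ge> 0"
  unfolding stein_def using \<Phi>_bounds[of "min w z"] \<Phi>_bounds[of "max w z"] \<phi>_pos[of w] by simp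

text \<open>For \<open>w \<ge> 0\<close> the second factor is at most the upper tail at \<open>w\<close>, for \<open>w < 0\<close> the first one is at most
  the lower tail, and by Mills' inequality either tail is at most \<open>\<phi>(w)/\<bar>w\<bar>\<close>.\<close>

lemma abs_mult_stein_le: "\<bar>w * stein z w\<bar> \<le> 1"
proof -
  let ?P = "\<Phi> (min w z)" and ?Q = "1 - \<Phi> (max w z)"
  have PQ: "0 \<le> ?P" "?P \<le> 1" "0 \<le> ?Q" "?Q \<le> 1" using \<Phi>_bounds by auto
  have "\<bar>w\<bar> * (?P * ?Q) \<le> \<phi> w"
  proof (cases "w \<ge> 0")
    case True
    have "w * (?P * ?Q) \<le> w * (1 * (1 - \<Phi> w))"
      using PQ True \<Phi>_mono[of w "max w z"] by (intro mult_left_mono mult_mono) auto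
    also have "\<dots> \<le> \<phi> w" using mills_upper[of w] True \<phi>_pos[of w] by (cases "w = 0") auto
    finally show ?thesis using True by simp
  next
    case False
    have "-w * (?P * ?Q) \<le> -w * (\<Phi> w * 1)"
      using PQ False \<Phi>_mono[of "min w z" w] by (intro mult_left_mono mult_mono) (auto simp: \<Phi>_bounds)
    also have "\<dots> \<le> \<phi> w" using mills_lower[of w] False by simp
    finally show ?thesis using False by simp
  qed
  moreover have "\<bar>w * stein z w\<bar> = \<bar>w\<bar> * (?P * ?Q) / \<phi> w"
    using PQ \<phi>_pos[of w] by (simp add: stein_def abs_mult)
  ultimately show ?thesis using \<phi>_pos[of w] by simp
qed

text \<open>Away from the origin this follows from the bound on \<open>w f(w)\<close>; near it, \<open>1/\<phi>\<close> is at most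
  \<open>sqrt (2 \<pi> e) < 5\<close>.\<close>

lemma stein_le: "stein z w \<le> 5"
proof (cases "\<bar>w\<bar> \<ge> 1")
  case True
  then have "1 * stein z w \<le> \<bar>w\<bar> * stein z w" using stein_nonneg by (intro mult_right_mono)
  also have "\<dots> \<le> 1" using abs_mult_stein_le[of w z] stein_nonneg[of z w] by (simp add: abs_mult)
  finally show ?thesis by simp
next
  case False
  have "exp (w\<^sup>2 / 2) * sqrt (2 * pi) \<le> 5"
  proof -
    have "w\<^sup>2 \<le> 1" using False by (simp add: abs_square_le_1)
    then have "exp (w\<^sup>2 / 2) \<le> exp (1 / 2 :: real)" by simp
    also have "\<dots> = sqrt (exp 1)" by (rule real_sqrt_unique[symmetric]) (simp_all add: power2_eq_square flip: exp_add)
    finally have "exp (w\<^sup>2 / 2) * sqrt (2 * pi) \<le> sqrt (exp 1) * sqrt (2 * pi)" 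
      by (intro mult_right_mono) auto
    also have "\<dots> = sqrt (exp 1 * (2 * pi))" by (simp only: real_sqrt_mult)
    also have "\<dots> \<le> sqrt (3 * (2 * 4))"
      using exp_le pi_less_4 by (intro real_sqrt_le_mono mult_mono) auto
    also have "\<dots> \<le> 5" by (simp add: real_le_lsqrt)
    finally show ?thesis .
  qed
  moreover have "stein z w \<le> 1 / \<phi> w"
    unfolding stein_def using \<Phi>_bounds[of "min w z"] \<Phi>_bounds[of "max w z"] \<phi>_pos[of w]
    by (intro divide_right_mono mult_le_one) auto
  moreover have "1 / \<phi> w = exp (w\<^sup>2 / 2) * sqrt (2 * pi)"
    by (simp add: std_normal_density_def exp_minus field_simps)
  ultimately show ?thesis by simp
qed

lemma DERIV_stein:
  assumes "w \<noteq> z"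
  shows "(stein z has_real_derivative w * stein z w + (if w \<le> z then 1 else 0) - \<Phi> z) (at w)"
proof (cases "w < z")
  case True
  have "((\<lambda>w. \<Phi> w * (1 - \<Phi> z) / \<phi> w) has_real_derivative w * stein z w + (if w \<le> z then 1 else 0) - \<Phi> z) (at w)"
    using True \<phi>_pos[of w]
    by (auto intro!: derivative_eq_intros DERIV_\<phi> DERIV_\<Phi> simp: stein_def field_simps)
  moreover have "eventually (\<lambda>u. stein z u = \<Phi> u * (1 - \<Phi> z) / \<phi> u) (nhds w)"
    using eventually_nhds_in_open[of "{..<z}" w] True
    by (auto elim!: eventually_mono simp: stein_def)
  ultimately show ?thesis by (subst DERIV_cong_ev[OF refl _ refl])
next
  case False
  then have zw: "z < w" using assms by simp
  have "((\<lambda>w. \<Phi> z * (1 - \<Phi> w) / \<phi> w) has_real_derivative w * stein z w + (if w \<le> z then 1 else 0) - \<Phi> z) (at w)"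
    using zw \<phi>_pos[of w]
    by (auto intro!: derivative_eq_intros DERIV_\<phi> DERIV_\<Phi> simp: stein_def field_simps)
  moreover have "eventually (\<lambda>u. stein z u = \<Phi> z * (1 - \<Phi> u) / \<phi> u) (nhds w)"
    using eventually_nhds_in_open[of "{z<..}" w] zw
    by (auto elim!: eventually_mono simp: stein_def)
  ultimately show ?thesis by (subst DERIV_cong_ev[OF refl _ refl])
qed

lemma continuous_stein: "continuous_on A (stein z)"
proof -
  have 1: "continuous_on UNIV \<Phi>" "continuous_on UNIV \<phi>"
    using DERIV_\<Phi> DERIV_\<phi> by (meson DERIV_isCont continuous_at_imp_continuous_on)+
  have "continuous_on A (\<lambda>w. \<Phi> (min w z) * (1 - \<Phi> (max w z)) / \<phi> w)"
    using \<phi>_pos by (intro continuous_intros continuous_on_compose2[OF 1(1)] continuous_on_subset[OF 1(2)])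
      (auto simp: less_imp_neq[OF \<phi>_pos, symmetric])
  then show ?thesis by (simp add: stein_def[abs_def])
qed

text \<open>The corner at \<open>z\<close> is harmless for the fundamental theorem of calculus, so that increments of the
  solution need no distinction of cases according to the position of \<open>z\<close>.\<close>

lemma stein_has_integral:
  assumes "a \<le> b"
  shows "((\<lambda>w. w * stein z w + (if w \<le> z then 1 else 0) - \<Phi> z) has_integral stein z b - stein z a) {a..b}"
  by (rule fundamental_theorem_of_calculus_interior_strong[of "{z}"])
    (use assms DERIV_stein continuous_stein in \<open>auto simp flip: has_real_derivative_iff_has_vector_derivative\<close>)

lemma stein_increment_bounds:
  assumes "a \<le> b" "\<And>w. a \<le> w \<Longrightarrow> w \<le> b \<Longrightarrow> c \<le> w * stein z w + (if w \<le> z then 1 else 0) - \<Phi> z"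
    and "\<And>w. a \<le> w \<Longrightarrow> w \<le> b \<Longrightarrow> w * stein z w + (if w \<le> z then 1 else 0) - \<Phi> z \<le> d"
  shows "(b - a) * c \<le> stein z b - stein z a" "stein z b - stein z a \<le> (b - a) * d"
proof -
  have "((\<lambda>w. c) has_integral (b - a) * c) {a..b}" "((\<lambda>w. d) has_integral (b - a) * d) {a..b}"
    using has_integral_const_real[of c a b] has_integral_const_real[of d a b] assms(1) by simp_all
  then show "(b - a) * c \<le> stein z b - stein z a" "stein z b - stein z a \<le> (b - a) * d"
    using stein_has_integral[OF assms(1), of z] assms(2,3) by (auto intro: has_integral_le)
qed

lemma stein_lipschitz: "\<bar>stein z a - stein z b\<bar> \<le> 2 * \<bar>a - b\<bar>"
proof -
  have b: "-2 \<le> w * stein z w + (if w \<le> z then 1 else 0) - \<Phi> z"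
    "w * stein z w + (if w \<le> z then 1 else 0) - \<Phi> z \<le> 2" for w
    using abs_mult_stein_le[of w z] \<Phi>_bounds[of z] by auto
  have "\<bar>stein z b - stein z a\<bar> \<le> 2 * (b - a)" if "a \<le> b" for a b
    using stein_increment_bounds[OF that, of "-2" z 2] b by fastforce
  from this[of a b] this[of b a] show ?thesis by (cases "a \<le> b") auto
qed

lemma mult_stein_lipschitz: "\<bar>x * stein z x - w * stein z w\<bar> \<le> (5 + 2 * \<bar>w\<bar>) * \<bar>x - w\<bar>"
proof -
  have "x * stein z x - w * stein z w = (x - w) * stein z x + w * (stein z x - stein z w)"
    by (simp add: algebra_simps)
  also have "\<bar>\<dots>\<bar> \<le> \<bar>x - w\<bar> * \<bar>stein z x\<bar> + \<bar>w\<bar> * \<bar>stein z x - stein z w\<bar>"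
    by (intro order.trans[OF abs_triangle_ineq]) (simp add: abs_mult)
  also have "\<dots> \<le> \<bar>x - w\<bar> * 5 + \<bar>w\<bar> * (2 * \<bar>x - w\<bar>)"
    using stein_nonneg[of z x] stein_le[of z x] stein_lipschitz[of z x w]
    by (intro add_mono mult_left_mono) auto
  finally show ?thesis by (simp add: algebra_simps)
qed

text \<open>The difference quotient over a lattice step, compared with the derivative that Stein's equation
  prescribes at a point of that step. The indicator contributes an error only if \<open>z\<close> is within one step.\<close>

lemma stein_increment_approx:
  assumes "\<delta> > 0" "w \<in> {u..u + \<delta>}"
  shows "\<bar>(stein z (u + \<delta>) - stein z u) / \<delta> - (w * stein z w + (if w \<le> z then 1 else 0) - \<Phi> z)\<bar>
    \<le> \<delta> * (5 + 2 * \<bar>w\<bar>) + (if \<bar>w - z\<bar> \<le> \<delta> then 1 else 0)"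
proof -
  let ?H = "\<lambda>x. x * stein z x + (if x \<le> z then 1 else 0) - \<Phi> z"
  let ?e = "\<delta> * (5 + 2 * \<bar>w\<bar>) + (if \<bar>w - z\<bar> \<le> \<delta> then 1 else 0)"
  have "\<bar>?H x - ?H w\<bar> \<le> ?e" if "u \<le> x" "x \<le> u + \<delta>" for x
  proof -
    have xw: "\<bar>x - w\<bar> \<le> \<delta>" using that assms by auto
    \<comment> \<open>the indicators at \<open>x\<close> and \<open>w\<close> differ only if \<open>z\<close> lies between them\<close>
    have "\<bar>x * stein z x - w * stein z w\<bar> \<le> (5 + 2 * \<bar>w\<bar>) * \<bar>x - w\<bar>" by (rule mult_stein_lipschitz)
    also have "\<dots> \<le> (5 + 2 * \<bar>w\<bar>) * \<delta>" using xw by (intro mult_left_mono) auto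
    finally show ?thesis using xw by (auto simp: mult.commute)
  qed
  then have "?H w - ?e \<le> ?H x" "?H x \<le> ?H w + ?e" if "u \<le> x" "x \<le> u + \<delta>" for x
    using that by (fastforce simp: abs_le_iff)+
  then have "\<delta> * (?H w - ?e) \<le> stein z (u + \<delta>) - stein z u" "stein z (u + \<delta>) - stein z u \<le> \<delta> * (?H w + ?e)"
    using stein_increment_bounds[of u "u + \<delta>" "?H w - ?e" z "?H w + ?e"] assms(1) by auto
  then have "?H w - ?e \<le> (stein z (u + \<delta>) - stein z u) / \<delta>" "(stein z (u + \<delta>) - stein z u) / \<delta> \<le> ?H w + ?e"
    using assms(1) by (simp_all add: pos_le_divide_eq pos_divide_le_eq mult.commute)
  then show ?thesis by (simp only: abs_le_iff) auto
qed

section \<open>The Berry-Esseen bound for Bernoulli sums\<close>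

text \<open>Let \<open>W = (S - \<mu>)/\<sigma>\<close> and let \<open>f\<close> solve Stein's equation. The covariance identity turns \<open>E W f(W)\<close>
  into the zero-bias expectation of a difference quotient of \<open>f\<close>. That quotient is close to
  \<open>w f(w) + 1{w \<le> z} - \<Phi>(z)\<close>, so by comparison \<open>E W f(W)\<close> is close to \<open>E W f(W) + P(W \<le> z) - \<Phi>(z)\<close>. The
  error is of order \<open>1/\<sigma>\<close>, the part coming from the jump at \<open>z\<close> by the concentration inequality.\<close>

theorem pb_berry_esseen:
  assumes "set qs \<subseteq> {0..1}" "pb_var qs = \<sigma>\<^sup>2" "\<sigma> > 0"
  shows "\<bar>pb_expect qs (\<lambda>k. if (real k - pb_mean qs) / \<sigma> \<le> z then 1 else 0) - \<Phi> z\<bar> \<le> 9 / \<sigma>"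
proof -
  define W where "W k = (real k - pb_mean qs) / \<sigma>" for k :: nat
  define \<delta> where "\<delta> = 1 / \<sigma>"
  define I where "I = (\<lambda>k. if W k \<le> z then 1 else 0 :: real)"
  define H where "H k = W k * stein z (W k) + I k - \<Phi> z" for k
  define err where "err k = \<delta> * (5 + 2 * \<bar>W k\<bar>) + (if \<bar>real k - (pb_mean qs + \<sigma> * z)\<bar> \<le> 1 then 1 else 0)" for k :: nat
  \<comment> \<open>the difference quotient of the solution, because consecutive values of \<open>W\<close> differ by \<open>1/\<sigma>\<close>\<close>
  define g where "g k = \<sigma> * (stein z (W (Suc k)) - stein z (W k))" for k
  have \<delta>: "\<delta> > 0" using assms(3) by (simp add: \<delta>_def)
  have per_\<delta>: "x / \<delta> = \<sigma> * x" for x by (simp add: \<delta>_def)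
  have WS: "W (Suc k) = W k + \<delta>" for k
    by (simp add: W_def \<delta>_def add_divide_distrib diff_divide_distrib)
  have near: "\<bar>W k - z\<bar> \<le> \<delta> \<longleftrightarrow> \<bar>real k - (pb_mean qs + \<sigma> * z)\<bar> \<le> 1" for k
  proof -
    have "\<bar>real k - (pb_mean qs + \<sigma> * z)\<bar> = \<bar>\<sigma> * (W k - z)\<bar>"
    proof -
      have "\<sigma> * W k = real k - pb_mean qs" using assms(3) by (simp add: W_def)
      then show ?thesis by (simp add: right_diff_distrib)
    qed
    also have "\<dots> = \<sigma> * \<bar>W k - z\<bar>" using assms(3) by (simp add: abs_mult)
    finally show ?thesis using assms(3) by (simp add: \<delta>_def field_simps)
  qed
  have approx: "\<bar>g k - H j\<bar> \<le> err j" if "j = k \<or> j = Suc k" for j k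
  proof -
    have "W j \<in> {W k..W k + \<delta>}" using that \<delta> WS by auto
    from stein_increment_approx[OF \<delta> this, of z] show ?thesis
      using per_\<delta> by (simp add: g_def H_def I_def err_def WS near)
  qed
  have bounds: "g k \<le> H k + err k" "g k \<le> H (Suc k) + err (Suc k)"
    "H k - err k \<le> g k" "H (Suc k) - err (Suc k) \<le> g k" for k
    using approx[of k k] approx[of "Suc k" k] by (simp_all add: abs_le_iff)
  have zb: "pb_zero_bias qs g = \<sigma>\<^sup>2 * pb_expect qs (\<lambda>k. W k * stein z (W k))"
  proof -
    have "pb_zero_bias qs g = \<sigma> * pb_expect qs (\<lambda>k. (real k - pb_mean qs) * stein z (W k))"
      unfolding g_def pb_zero_bias_cmult by (simp add: pb_covariance_identity)
    also have "(\<lambda>k. (real k - pb_mean qs) * stein z (W k)) = (\<lambda>k. \<sigma> * (W k * stein z (W k)))"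
      using assms(3) by (auto simp: W_def)
    finally show ?thesis by (simp add: pb_expect_cmult power2_eq_square)
  qed
  have EH: "pb_expect qs H = pb_expect qs (\<lambda>k. W k * stein z (W k)) + pb_expect qs I - \<Phi> z"
    unfolding H_def by (simp only: pb_expect_diff pb_expect_add pb_expect_const)
  have s2: "\<sigma>\<^sup>2 > 0" using assms(3) by simp
  have "pb_zero_bias qs g \<le> pb_var qs * pb_expect qs (\<lambda>k. H k + err k)"
    by (rule pb_zero_bias_le[OF assms(1)]) (simp_all only: bounds)
  then have "pb_expect qs (\<lambda>k. W k * stein z (W k)) \<le> pb_expect qs H + pb_expect qs err"
    using s2 unfolding zb assms(2) pb_expect_add by simp
  moreover have "pb_var qs * pb_expect qs (\<lambda>k. H k - err k) \<le> pb_zero_bias qs g"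
    by (rule pb_zero_bias_ge[OF assms(1)]) (simp_all only: bounds)
  then have "pb_expect qs H - pb_expect qs err \<le> pb_expect qs (\<lambda>k. W k * stein z (W k))"
    using s2 unfolding zb assms(2) pb_expect_diff by simp
  ultimately have main: "\<bar>pb_expect qs I - \<Phi> z\<bar> \<le> pb_expect qs err"
    unfolding EH by auto
  have EW: "pb_expect qs (\<lambda>k. \<bar>W k\<bar>) \<le> 1"
  proof -
    have "(\<lambda>k. \<bar>W k\<bar>) = (\<lambda>k. \<delta> * \<bar>real k - pb_mean qs\<bar>)"
      using assms(3) by (auto simp: W_def \<delta>_def abs_divide)
    then have "pb_expect qs (\<lambda>k. \<bar>W k\<bar>) \<le> \<delta> * \<sigma>"
      using pb_abs_moment[OF assms] \<delta> by (simp add: pb_expect_cmult)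
    then show ?thesis using assms(3) by (simp add: \<delta>_def)
  qed
  have "pb_expect qs err = \<delta> * (5 + 2 * pb_expect qs (\<lambda>k. \<bar>W k\<bar>))
      + pb_expect qs (\<lambda>k. if \<bar>real k - (pb_mean qs + \<sigma> * z)\<bar> \<le> 1 then 1 else 0)"
    unfolding err_def by (simp only: pb_expect_add pb_expect_cmult pb_expect_const)
  also have "\<dots> \<le> \<delta> * (5 + 2 * 1) + (1 + 1) / \<sigma>"
    using \<delta> EW by (intro add_mono mult_left_mono pb_concentration[OF assms]) auto
  also have "\<dots> = 9 / \<sigma>" by (simp add: \<delta>_def)
  finally show ?thesis using main by (simp add: I_def W_def)
qed

section \<open>The law of LA as a Bernoulli sum\<close>

definition LA_poly :: "nat \<Rightarrow> complex poly" where
  "LA_poly n = LA_sum n (\<lambda>k. monom 1 k)"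

lemma LA_poly_0: "LA_poly 0 = 1"
  by (simp add: LA_poly_def LA_sum_0 monom_0 flip: one_pCons)

text \<open>The recurrence for \<open>LA_sum\<close> read on powers of \<open>X\<close>: multiplication of \<open>X\<^sup>k\<close> by \<open>k\<close> is the operator
  \<open>X d/dX\<close>.\<close>

lemma LA_poly_Suc:
  "LA_poly (Suc n) = [:0, 1, 0, -1:] * pderiv (LA_poly n) + [:0, 1, of_nat n:] * LA_poly n"
proof -
  have "of_nat k * monom 1 k + monom 1 (k + 1) + (of_nat n - of_nat k) * monom 1 (k + 2)
      = [:0, 1, 0, -1:] * pderiv (monom 1 k) + [:0, 1, of_nat n:] * (monom 1 k :: complex poly)" for k
  proof -
    have 1: "[:0, 1, 0, -1:] = monom 1 1 - monom (1 :: complex) 3"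
      and 2: "[:0, 1, of_nat n:] = monom 1 1 + monom (of_nat n :: complex) 2"
      by (simp_all add: monom_Suc monom_0 numeral_2_eq_2 numeral_3_eq_3)
    have c: "of_nat m = monom (of_nat m :: complex) 0" for m
      by (simp add: of_nat_poly monom_0)
    show ?thesis
      unfolding 1 2 c pderiv_monom
      by (cases k) (simp_all add: algebra_simps mult_monom add_monom numeral_2_eq_2 numeral_3_eq_3)
  qed
  moreover have "pderiv (sum f A) = (\<Sum>x\<in>A. pderiv (f x))" for f :: "real list \<Rightarrow> complex poly" and A
    using higher_pderiv_sum[of 1 f A] by simp
  ultimately show ?thesis
    unfolding LA_poly_def LA_sum_Suc unfolding LA_sum_def by (simp only: sum_distrib_left sum.distrib)
qed

lemma mult_pderiv_power:
  fixes p :: "complex poly"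
  shows "p * pderiv (p ^ m) = of_nat m * pderiv p * p ^ m"
proof (cases m)
  case (Suc k)
  then show ?thesis
    by (simp only: pderiv_power_Suc) (simp add: of_nat_poly algebra_simps)
qed simp

text \<open>The operator in the recurrence is \<open>X (1 - X\<^sup>2) d/dX + X + n X\<^sup>2\<close>, and at every second step it produces one
  more zero at \<open>-1\<close>. Once these zeros are divided out, the cofactors satisfy recurrences given by polar
  derivatives, which create no zeros off the nonpositive axis.\<close>

lemma LA_poly_factor:
  "\<exists>S. LA_poly n = [:1, 1:] ^ (n div 2) * S \<and> degree S \<le> (n + 1) div 2
      \<and> (\<forall>z. z \<notin> \<real>\<^sub>\<le>\<^sub>0 \<longrightarrow> poly S z \<noteq> 0)"
proof (induction n)
  case 0
  show ?case by (intro exI[of _ 1]) (simp add: LA_poly_0)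
next
  case (Suc n)
  then obtain S where S: "LA_poly n = [:1, 1:] ^ (n div 2) * S" "degree S \<le> (n + 1) div 2"
    and nz: "\<And>z. z \<notin> \<real>\<^sub>\<le>\<^sub>0 \<Longrightarrow> poly S z \<noteq> 0" by blast
  define m where "m = n div 2"
  define E where "E = ([:1, 1:] :: complex poly)"
  define P where "P = E ^ m"
  have EP: "E * pderiv P = of_nat m * P"
    using mult_pderiv_power[of E m] by (simp add: P_def E_def pderiv_pCons)
  have cubic: "[:0, 1, 0, -1:] = [:0, 1, -1:] * E" by (simp add: E_def)
  have T: "LA_poly (Suc n) = [:0, 1, -1:] * (of_nat m * P * S + E * P * pderiv S) + [:0, 1, of_nat n:] * (P * S)"
  proof -
    have "LA_poly (Suc n) = [:0, 1, -1:] * ((E * pderiv P) * S + E * P * pderiv S) + [:0, 1, of_nat n:] * (P * S)"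
      unfolding LA_poly_Suc S(1) cubic by (simp add: pderiv_mult P_def E_def m_def algebra_simps)
    then show ?thesis unfolding EP .
  qed
  have T': "LA_poly (Suc n) = P * (([:0, 1, -1:] * of_nat m + [:0, 1, of_nat n:]) * S + [:0, 1, -1:] * E * pderiv S)"
    unfolding T by (simp only: algebra_simps)
  show ?case
  proof (cases "even n")
    case True
    then have n: "n = 2 * m" by (simp add: m_def)
    define S' where "S' = [:0, 1, 0, -1:] * pderiv S + [:0, of_nat (Suc m), of_nat m:] * S"
    have deg: "degree S \<le> m" using S(2) n by simp
    have "[:0, 1, -1:] * of_nat m + [:0, 1, of_nat n:] = [:0, of_nat (Suc m), of_nat m :: complex:]"
      by (simp add: n of_nat_poly)
    then have "LA_poly (Suc n) = P * S'"
      unfolding T' S'_def cubic by (simp only: algebra_simps)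
    moreover have "degree S' \<le> Suc m" unfolding S'_def by (rule degree_odd_step[OF deg])
    moreover have "poly S' z \<noteq> 0" if "z \<notin> \<real>\<^sub>\<le>\<^sub>0" for z
      unfolding S'_def using nz that by (intro nonvanishing_odd_step[OF deg])
    ultimately show ?thesis using n by (intro exI[of _ S']) (simp add: P_def E_def)
  next
    case False
    then have n: "n = 2 * m + 1" by (simp add: m_def)
    define S' where "S' = [:0, 1, -1:] * pderiv S + [:0, of_nat (Suc m):] * S"
    have deg: "degree S \<le> Suc m" using S(2) n by simp
    have "[:0, 1, -1:] * of_nat m + [:0, 1, of_nat n:] = E * [:0, of_nat (Suc m) :: complex:]"
      by (simp add: n of_nat_poly E_def)
    then have "LA_poly (Suc n) = E * P * S'"
      unfolding T' S'_def by (simp only: algebra_simps)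
    moreover have "degree S' \<le> Suc m" unfolding S'_def by (rule degree_even_step[OF deg])
    moreover have "poly S' z \<noteq> 0" if "z \<notin> \<real>\<^sub>\<le>\<^sub>0" for z
      unfolding S'_def using nz that by (intro nonvanishing_even_step[OF deg])
    ultimately show ?thesis using n by (intro exI[of _ S']) (simp add: P_def E_def)
  qed
qed

lemma LA_sum_const: "LA_sum n (\<lambda>k. c) = of_nat (fact n) * c"
  by (simp add: LA_sum_def card_image)

text \<open>The linear functional on polynomials that sends \<open>X\<^sup>k\<close> to \<open>f k\<close>.\<close>

definition coeff_sum :: "(nat \<Rightarrow> 'a::comm_ring_1) \<Rightarrow> 'a poly \<Rightarrow> 'a" where
  "coeff_sum f p = (\<Sum>k\<le>degree p. coeff p k * f k)"

lemma coeff_sum_bound: "degree p \<le> N \<Longrightarrow> coeff_sum f p = (\<Sum>k\<le>N. coeff p k * f k)"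
  unfolding coeff_sum_def by (intro sum.mono_neutral_left) (auto simp: coeff_eq_0)

lemma coeff_sum_add: "coeff_sum f (p + q) = coeff_sum f p + coeff_sum f q"
proof -
  let ?N = "max (degree p) (degree q)"
  show ?thesis
    using coeff_sum_bound[of p ?N f] coeff_sum_bound[of q ?N f] coeff_sum_bound[of "p + q" ?N f]
    by (simp add: degree_add_le_max sum.distrib algebra_simps)
qed

lemma coeff_sum_0: "coeff_sum f 0 = 0"
  by (simp add: coeff_sum_def)

lemma coeff_sum_sum: "coeff_sum f (\<Sum>x\<in>A. p x) = (\<Sum>x\<in>A. coeff_sum f (p x))"
  by (induction A rule: infinite_finite_induct) (simp_all add: coeff_sum_0 coeff_sum_add)

lemma coeff_sum_smult: "coeff_sum f (smult c p) = c * coeff_sum f p"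
  using coeff_sum_bound[of "smult c p" "degree p" f] degree_smult_le[of c p]
  by (simp add: coeff_sum_def sum_distrib_left mult.assoc)

lemma coeff_sum_pCons_0: "coeff_sum f (pCons 0 p) = coeff_sum (\<lambda>k. f (Suc k)) p"
proof -
  have "coeff_sum f (pCons 0 p) = (\<Sum>k\<le>Suc (degree p). coeff (pCons 0 p) k * f k)"
    by (rule coeff_sum_bound) (rule degree_pCons_le)
  then show ?thesis by (simp add: coeff_sum_def sum.atMost_Suc_shift del: sum.atMost_Suc)
qed

lemma coeff_sum_monom: "coeff_sum f (monom 1 k) = f k"
proof -
  have "coeff_sum f (monom 1 k) = (\<Sum>i\<le>k. coeff (monom 1 k) i * f i)"
    by (rule coeff_sum_bound) (rule degree_monom_le)
  also have "\<dots> = (\<Sum>i\<le>k. if i = k then f i else 0)"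
    by (intro sum.cong) (auto simp: coeff_monom)
  finally show ?thesis by simp
qed

lemma coeff_sum_binomial_factors:
  "coeff_sum (\<lambda>k. complex_of_real (f k)) (\<Prod>q\<leftarrow>qs. [:1 - complex_of_real q, complex_of_real q:])
    = complex_of_real (pb_expect qs f)"
proof (induction qs arbitrary: f)
  case Nil
  then show ?case by (simp add: coeff_sum_def)
next
  case (Cons q qs)
  let ?p = "\<Prod>q\<leftarrow>qs. [:1 - complex_of_real q, complex_of_real q:]"
  have "[:1 - complex_of_real q, complex_of_real q:] * ?p
      = smult (1 - complex_of_real q) ?p + smult (complex_of_real q) (pCons 0 ?p)"
    by simp
  then show ?case
    by (simp only: list.map prod_list.Cons coeff_sum_add coeff_sum_smult coeff_sum_pCons_0 Cons.IH) simp
qed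

text \<open>The generating polynomial has only real nonpositive zeros, hence up to the factor \<open>n!\<close> it is a
  product of generating functions of Bernoulli variables.\<close>

theorem LA_poisson_binomial:
  "\<exists>qs. set qs \<subseteq> {0..1} \<and> (\<forall>f. LA_sum n f = fact n * pb_expect qs f)"
proof -
  obtain S where S: "LA_poly n = [:1, 1:] ^ (n div 2) * S" "\<And>z. z \<notin> \<real>\<^sub>\<le>\<^sub>0 \<Longrightarrow> poly S z \<noteq> 0"
    using LA_poly_factor by blast
  have "poly (LA_poly n) z \<noteq> 0" if "z \<notin> \<real>\<^sub>\<le>\<^sub>0" for z
  proof -
    have "z \<noteq> -1" using that by auto
    then have "1 + z \<noteq> 0" by (metis add_eq_0_iff)
    then show ?thesis using S(2)[OF that] by (simp add: S(1) poly_power)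
  qed
  then obtain qs where qs: "set qs \<subseteq> {0..1}"
    "LA_poly n = smult (poly (LA_poly n) 1) (\<Prod>q\<leftarrow>qs. [:1 - complex_of_real q, complex_of_real q:])"
    using nonpos_roots_imp_binomial_factors by blast
  have one: "poly (LA_poly n) 1 = fact n"
    by (simp add: LA_poly_def LA_sum_def poly_sum poly_monom card_image)
  have "LA_sum n f = fact n * pb_expect qs f" for f
  proof -
    have "complex_of_real (LA_sum n f) = coeff_sum (\<lambda>k. complex_of_real (f k)) (LA_poly n)"
      by (simp add: LA_poly_def LA_sum_def coeff_sum_sum coeff_sum_monom)
    also have "\<dots> = fact n * complex_of_real (pb_expect qs f)"
      by (subst qs(2)) (simp only: coeff_sum_smult coeff_sum_binomial_factors one)
    also have "\<dots> = complex_of_real (fact n * pb_expect qs f)" by simp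
    finally show ?thesis by (simp only: of_real_eq_iff)
  qed
  with qs(1) show ?thesis by blast
qed

section \<open>Moments and the normal approximation\<close>

lemma LA_sum_add: "LA_sum n (\<lambda>k. f k + g k) = LA_sum n f + LA_sum n g"
  by (simp add: LA_sum_def sum.distrib)

lemma LA_sum_cmult: "LA_sum n (\<lambda>k. c * f k) = c * LA_sum n f"
  by (simp add: LA_sum_def sum_distrib_left)

text \<open>Inserting a maximum raises \<open>LA\<close> by \<open>(2n + 1 - 2 LA)/(n + 1)\<close> on average, so the mean obeys a linear
  recurrence. The closed form fails for \<open>n = 1\<close>.\<close>

lemma LA_sum_first_moment:
  assumes "n \<ge> 2"
  shows "LA_sum n real = fact n * (2 * real n / 3 + 1 / 6)"
  using assms
proof (induction n rule: dec_induct)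
  case base
  show ?case by (simp add: numeral_2_eq_2 LA_sum_Suc LA_sum_0)
next
  case (step n)
  have "LA_sum (Suc n) real = LA_sum n (\<lambda>k. (real n - 1) * real k + (2 * real n + 1))"
    unfolding LA_sum_Suc by (intro arg_cong[of _ _ "LA_sum n"]) (auto simp: algebra_simps)
  also have "\<dots> = (real n - 1) * (fact n * (2 * real n / 3 + 1 / 6)) + fact n * (2 * real n + 1)"
    unfolding LA_sum_add LA_sum_cmult LA_sum_const step.IH by (simp add: algebra_simps)
  finally show ?case by (simp add: field_simps)
qed

text \<open>The second moment obeys a linear recurrence too. Its homogeneous solution is killed at \<open>n = 3\<close>, where
  the factor \<open>n - 3\<close> vanishes; this is why the closed form begins at \<open>n = 4\<close>.\<close>

lemma LA_sum_second_moment: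
  assumes "n \<ge> 4"
  shows "LA_sum n (\<lambda>k. (real k)\<^sup>2)
     = fact n * ((2 * real n / 3 + 1 / 6)\<^sup>2 + (8 * real n / 45 - 13 / 180))"
  using assms
proof (induction n rule: dec_induct)
  case base
  show ?case by (simp add: eval_nat_numeral LA_sum_Suc LA_sum_0)
next
  case (step n)
  have first: "LA_sum n real = fact n * (2 * real n / 3 + 1 / 6)"
    using step.hyps by (intro LA_sum_first_moment) simp
  have "LA_sum (Suc n) (\<lambda>k. (real k)\<^sup>2)
      = LA_sum n (\<lambda>k. (real n - 3) * (real k)\<^sup>2 + ((4 * real n - 2) * real k + (4 * real n + 1)))"
    unfolding LA_sum_Suc
    by (intro arg_cong[of _ _ "LA_sum n"]) (auto simp: algebra_simps power2_eq_square)
  also have "\<dots> = (real n - 3) * (fact n * ((2 * real n / 3 + 1 / 6)\<^sup>2 + (8 * real n / 45 - 13 / 180)))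
      + ((4 * real n - 2) * (fact n * (2 * real n / 3 + 1 / 6)) + fact n * (4 * real n + 1))"
    unfolding LA_sum_add LA_sum_cmult LA_sum_const step.IH first by (simp add: algebra_simps)
  finally show ?case by (simp add: field_simps power2_eq_square)
qed

lemma cdf_LA:
  "cdf (distr (measure_pmf (uniform_perm n)) borel (\<lambda>\<pi>. h (LA_perm n \<pi>))) z
    = LA_sum n (\<lambda>k. if h k \<le> z then 1 else 0) / fact n"
proof -
  let ?P = "{\<pi>. \<pi> permutes {1..n}}"
  have fin: "finite ?P" "?P \<noteq> {}" by (auto simp: finite_permutations intro: permutes_id)
  have "cdf (distr (measure_pmf (uniform_perm n)) borel (\<lambda>\<pi>. h (LA_perm n \<pi>))) z
      = measure (measure_pmf (pmf_of_set ?P)) {\<pi>. h (LA_perm n \<pi>) \<le> z}"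
    unfolding cdf_def uniform_perm_def
    by (subst measure_distr) (auto intro!: arg_cong[of _ _ "measure _"])
  also have "\<dots> = card (?P \<inter> {\<pi>. h (LA_perm n \<pi>) \<le> z}) / card ?P"
    by (rule measure_pmf_of_set[OF fin(2,1)])
  also have "card ?P = fact n" by (simp add: card_permutations)
  also have "real (card (?P \<inter> {\<pi>. h (LA_perm n \<pi>) \<le> z})) = (\<Sum>\<pi>\<in>?P. if h (LA_perm n \<pi>) \<le> z then 1 else 0)"
    using fin(1) by (simp add: sum.If_cases)
  also have "\<dots> = LA_sum n (\<lambda>k. if h k \<le> z then 1 else 0)" by (rule LA_sum_perm)
  finally show ?thesis by simp
qed

theorem LA_berry_esseen:
  assumes "n \<ge> 4"
  defines "\<sigma> \<equiv> sqrt (8 * real n / 45 - 13 / 180)"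
  shows "\<bar>LA_sum n (\<lambda>k. if (real k - (2 * real n / 3 + 1 / 6)) / \<sigma> \<le> z then 1 else 0) / fact n - \<Phi> z\<bar> \<le> 9 / \<sigma>"
proof -
  obtain qs where qs: "set qs \<subseteq> {0..1}" and E: "\<And>f. LA_sum n f = fact n * pb_expect qs f"
    using LA_poisson_binomial by metis
  define m where "m = 2 * real n / 3 + 1 / 6"
  have mean: "pb_mean qs = m"
    using LA_sum_first_moment[of n] assms(1) unfolding E pb_mean by (simp add: m_def)
  have second: "pb_expect qs (\<lambda>k. (real k)\<^sup>2) = m\<^sup>2 + (8 * real n / 45 - 13 / 180)"
    using LA_sum_second_moment[OF assms(1)] unfolding E by (simp add: m_def)
  have square: "(x - m)\<^sup>2 = x\<^sup>2 + ((-2 * m) * x + m\<^sup>2)" for x :: real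
    by (simp add: power2_eq_square algebra_simps)
  have "pb_var qs = m\<^sup>2 + (8 * real n / 45 - 13 / 180) + ((-2 * m) * m + m\<^sup>2)"
    unfolding pb_variance[symmetric] mean square pb_expect_add pb_expect_cmult pb_mean second
      pb_expect_const ..
  also have "\<dots> = 8 * real n / 45 - 13 / 180" by (simp add: power2_eq_square)
  also have "\<dots> = \<sigma>\<^sup>2" using assms by simp
  finally have var: "pb_var qs = \<sigma>\<^sup>2" .
  have "\<sigma> > 0" using assms by simp
  from pb_berry_esseen[OF qs var this, of z] show ?thesis unfolding E mean m_def by simp
qed

text \<open>For \<open>n \<ge> 4\<close> the variance is at least \<open>n/10\<close>, and \<open>9 sqrt 10 \<le> 30\<close>. For \<open>n < 4\<close>, where the normalising
  constants need not be the mean and the standard deviation of \<open>LA\<close>, the right-hand side exceeds the trivial bound 1.\<close>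

theorem theorem4p3:
  "\<exists>C :: real. \<forall>n :: nat. n \<ge> 1 \<longrightarrow>
     kolmogorov_dist
       (distr (measure_pmf (uniform_perm n)) borel
          (\<lambda>\<pi>. (real (LA_perm n \<pi>) - (2 * real n / 3 + 1 / 6))
                / sqrt (8 * real n / 45 - 13 / 180)))
       std_normal_distribution
     \<le> C / sqrt (real n)"
proof (intro exI[of _ 30] allI impI)
  fix n :: nat
  assume n: "n \<ge> 1"
  let ?\<sigma> = "sqrt (8 * real n / 45 - 13 / 180)"
  let ?h = "\<lambda>k. (real k - (2 * real n / 3 + 1 / 6)) / ?\<sigma>"
  let ?L = "distr (measure_pmf (uniform_perm n)) borel (\<lambda>\<pi>. ?h (LA_perm n \<pi>))"
  have "\<bar>cdf ?L z - cdf std_normal_distribution z\<bar> \<le> 30 / sqrt (real n)" for z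
  proof (cases "n \<ge> 4")
    case True
    have "sqrt (real n / 10) \<le> ?\<sigma>" using True by (intro real_sqrt_le_mono) simp
    then have s: "sqrt (real n) \<le> sqrt 10 * ?\<sigma>" by (simp add: real_sqrt_divide field_simps)
    have "sqrt 10 * 9 \<le> (30 :: real)"
    proof -
      have "sqrt 10 \<le> sqrt ((10 / 3)\<^sup>2)" by (intro real_sqrt_le_mono) (simp add: power2_eq_square)
      then show ?thesis by simp
    qed
    moreover have "?\<sigma> > 0" using True by simp
    ultimately have "9 * sqrt (real n) \<le> 30 * ?\<sigma>"
      using s mult_right_mono[of "sqrt 10 * 9" 30 ?\<sigma>] by linarith
    then have "9 / ?\<sigma> \<le> 30 / sqrt (real n)" using \<open>?\<sigma> > 0\<close> n by (simp add: field_simps)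
    then show ?thesis
      using LA_berry_esseen[OF True, of z] unfolding cdf_LA[of n ?h z] \<Phi>_def by linarith
  next
    case False
    interpret D: real_distribution ?L
      by (rule prob_space.real_distribution_distr[OF prob_space_measure_pmf]) simp
    have "\<bar>cdf ?L z - cdf std_normal_distribution z\<bar> \<le> 1"
      using D.cdf_nonneg[of z] D.cdf_bounded_prob[of z] \<Phi>_bounds[of z] unfolding \<Phi>_def by linarith
    also have "1 \<le> 30 / sqrt (real n)"
    proof -
      have "sqrt (real n) \<le> sqrt 4" using False by (intro real_sqrt_le_mono) simp
      then show ?thesis using n by (simp add: field_simps)
    qed
    finally show ?thesis .
  qed
  then show "kolmogorov_dist ?L std_normal_distribution \<le> 30 / sqrt (real n)"
    unfolding kolmogorov_dist_def by (intro cSUP_least) auto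
qed

end
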